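(* Let $R=\mathbf{C}[\xi_1,\xi_2,\ldots]$ with its natural action of the infinite symmetric group $\mathfrak{S}$. Every non-zero $\mathfrak{S}$-prime of $R$ is of the form $\mathfrak{P}(\lambda,e;Z)$ for some $\infty$-partition $\lambda=(\lambda_1,\ldots,\lambda_r)$, some $\lambda$-reduced weight vector $e=(e_1,\ldots,e_r)$, and some irreducible Zariski closed subset $Z$ of $\mathbf{U}^r$.
   Context: $[\infty]=\{1,2,3,\ldots\}$ and $\mathfrak{S}=\bigcup_{n\ge 1}\mathfrak{S}_n$ is the group of permutations of $[\infty]$ moving only finitely many elements; it acts on $R$ by $\mathbf{C}$-algebra automorphisms permuting the variables. An $\mathfrak{S}$-ideal is an $\mathfrak{S}$-stable ideal of $R$. An $\mathfrak{S}$-ideal $\mathfrak{p}\ne R$ is $\mathfrak{S}$-prime if for all $\mathfrak{S}$-ideals $\mathfrak{a},\mathfrak{b}$, $\mathfrak{a}\mathfrak{b}\subset\mathfrak{p}$ implies $\mathfrak{a}\subset\mathfrak{p}$ or $\mathfrak{b}\subset\mathfrak{p}$. An $\infty$-partition is a finite tuple $\lambda=(\lambda_1,\ldots,\lambda_r)$ with $\lambda_i\in\{1,2,\ldots\}\cup\{\infty\}$, $\lambda_i\ge\lambda_{i+1}$ and $\lambda_1=\infty$. A weight vector is a tuple $e=(e_1,\ldots,e_r)$ of positive integers; it is ($\lambda$-)reduced if $e_i=1$ whenever $\lambda_i$ is finite. $\mathbf{U}^r\subset\mathbf{A}^r$ is the open subset of complex affine space where all coordinates are distinct. A partition of $[\infty]$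 of type $\lambda$ is a tuple $\mathcal{U}=(U_1,\ldots,U_r)$ of disjoint non-empty subsets of $[\infty]$ with union $[\infty]$ and $\#U_j=\lambda_j$; $\pi\colon[\infty]\to\{1,\ldots,r\}$ is defined by $i\in U_{\pi(i)}$. For $Z\subset\mathbf{U}^r$ closed, $\mathfrak{X}_{[\mathcal{U}]}(Z)$ is the set of points $x=(x_i)_{i\ge1}$, $x_i\in\mathbf{C}$, for which there is a $\mathbf{C}$-point $z=(z_1,\ldots,z_r)$ of $Z$ with $x_i=z_{\pi(i)}$ for all $i$. For $\lambda$ an $\infty$-partition, $e$ a reduced weight vector and $Z\subset\mathbf{U}^r$ irreducible closed, $\mathfrak{P}(\lambda,e;Z)$ is the $\mathfrak{S}$-ideal of all $f\in R$ such that for every partition $\mathcal{U}$ of $[\infty]$ of type $\lambda$ and every $x\in\mathfrak{X}_{[\mathcal{U}]}(Z)$ one has $(\partial_{i_1}^{k_1}\cdots\partial_{i_m}^{k_m}f)(x)=0$ for every $m\ge 0$, all distinct indices $i_1,\ldots,i_m\in[\infty]$ and all integers $0\le k_j<e_{\pi(i_j)}$, where $\partial_i=\partial/\partial\xi_i$. *)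

theory Defs
  imports
    Complex_Main
    "HOL-Library.Poly_Mapping"
    "HOL-Library.Extended_Nat"
    "HOL-Combinatorics.Permutations"
begin

text \<open>The infinite set \<open>[\<infinity>] = {1, 2, \<dots>}\<close> of indices is represented by the type \<^typ>\<open>nat\<close>
  (indices start at 0), and likewise tuples of length \<open>r\<close> are lists indexed by \<open>0, \<dots>, r - 1\<close>.
  \<open>R\<close> is the monoid algebra over the complex numbers of the finitely supported exponent
  vectors; its ring structure is that of \<open>Poly_Mapping\<close>.\<close>

type_synonym monom = "nat \<Rightarrow>\<^sub>0 nat"
type_synonym R = "monom \<Rightarrow>\<^sub>0 complex"

definition const :: "complex \<Rightarrow> R" where
  "const c = Poly_Mapping.single 0 c"

definition var :: "nat \<Rightarrow> R" where
  "var i = Poly_Mapping.single (Poly_Mapping.single i 1) 1"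

definition vars :: "R \<Rightarrow> nat set" where
  "vars f = (\<Union>m\<in>Poly_Mapping.keys f. Poly_Mapping.keys m)"

text \<open>The ring homomorphism from \<open>R\<close> that restricts to \<open>h\<close> on constants and sends the
  \<open>i\<close>-th variable to \<open>x i\<close>.\<close>

definition subst :: "(complex \<Rightarrow> 'a::comm_semiring_1) \<Rightarrow> (nat \<Rightarrow> 'a) \<Rightarrow> R \<Rightarrow> 'a" where
  "subst h x f = (\<Sum>m\<in>Poly_Mapping.keys f. h (Poly_Mapping.lookup f m) * (\<Prod>i\<in>Poly_Mapping.keys m. x i ^ Poly_Mapping.lookup m i))"

definition eval :: "(nat \<Rightarrow> complex) \<Rightarrow> R \<Rightarrow> complex" where
  "eval x f = subst (\<lambda>c. c) x f"

definition act :: "(nat \<Rightarrow> nat) \<Rightarrow> R \<Rightarrow> R" where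
  "act \<sigma> f = subst const (\<lambda>i. var (\<sigma> i)) f"

definition partial :: "nat \<Rightarrow> R \<Rightarrow> R" where
  "partial i f = (\<Sum>m\<in>Poly_Mapping.keys f.
     Poly_Mapping.single (m - Poly_Mapping.single i 1) (of_nat (Poly_Mapping.lookup m i) * Poly_Mapping.lookup f m))"

interpretation ideal: module "(*) :: R \<Rightarrow> R \<Rightarrow> R"
  by unfold_locales (simp_all add: algebra_simps)

definition ideal_prod :: "R set \<Rightarrow> R set \<Rightarrow> R set" where
  "ideal_prod A B = ideal.span {f * g | f g. f \<in> A \<and> g \<in> B}"

text \<open>\<^const>\<open>permutation\<close> says that \<open>\<sigma>\<close> is a bijection that moves only finitely many elements.\<close>

definition S_ideal :: "R set \<Rightarrow> bool" where
  "S_ideal I \<longleftrightarrow> ideal.subspace I \<and> (\<forall>\<sigma>. permutation \<sigma> \<longrightarrow> (\<forall>f\<in>I. act \<sigma> f \<in> I))"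

definition S_prime :: "R set \<Rightarrow> bool" where
  "S_prime P \<longleftrightarrow> S_ideal P \<and> P \<noteq> UNIV \<and>
     (\<forall>A B. S_ideal A \<longrightarrow> S_ideal B \<longrightarrow> ideal_prod A B \<subseteq> P \<longrightarrow> A \<subseteq> P \<or> B \<subseteq> P)"

definition inf_partition :: "enat list \<Rightarrow> bool" where
  "inf_partition l \<longleftrightarrow> l \<noteq> [] \<and> hd l = \<infinity> \<and> sorted_wrt (\<ge>) l \<and> (\<forall>a\<in>set l. 1 \<le> a)"

definition weight_vector :: "nat \<Rightarrow> nat list \<Rightarrow> bool" where
  "weight_vector r e \<longleftrightarrow> length e = r \<and> (\<forall>k\<in>set e. 1 \<le> k)"

definition reduced :: "enat list \<Rightarrow> nat list \<Rightarrow> bool" where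
  "reduced l e \<longleftrightarrow> (\<forall>j<length l. l ! j \<noteq> \<infinity> \<longrightarrow> e ! j = 1)"

text \<open>Varieties are given by their sets of complex points; a point of affine \<open>r\<close>-space is a list
  of length \<open>r\<close>, and polynomials on it are the elements of \<open>R\<close> in the first \<open>r\<close> variables.\<close>

definition zariski_closed :: "nat \<Rightarrow> complex list set \<Rightarrow> bool" where
  "zariski_closed r V \<longleftrightarrow> (\<exists>F. (\<forall>f\<in>F. vars f \<subseteq> {..<r}) \<and>
     V = {z. length z = r \<and> (\<forall>f\<in>F. eval (\<lambda>j. z ! j) f = 0)})"

definition Udist :: "nat \<Rightarrow> complex list set" where
  "Udist r = {z. length z = r \<and> distinct z}"

definition closed_in_U :: "nat \<Rightarrow> complex list set \<Rightarrow> bool" where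
  "closed_in_U r Z \<longleftrightarrow> (\<exists>V. zariski_closed r V \<and> Z = V \<inter> Udist r)"

definition irreducible_closed_in_U :: "nat \<Rightarrow> complex list set \<Rightarrow> bool" where
  "irreducible_closed_in_U r Z \<longleftrightarrow> closed_in_U r Z \<and> Z \<noteq> {} \<and>
     (\<forall>A B. closed_in_U r A \<longrightarrow> closed_in_U r B \<longrightarrow> Z = A \<union> B \<longrightarrow> Z = A \<or> Z = B)"

definition ecard :: "'a set \<Rightarrow> enat" where
  "ecard A = (if finite A then enat (card A) else \<infinity>)"

definition partition_of_type :: "enat list \<Rightarrow> nat set list \<Rightarrow> bool" where
  "partition_of_type l U \<longleftrightarrow> length U = length l \<and>
     (\<forall>j<length U. U ! j \<noteq> {} \<and> ecard (U ! j) = l ! j) \<and>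
     (\<forall>j<length U. \<forall>k<length U. j \<noteq> k \<longrightarrow> U ! j \<inter> U ! k = {}) \<and>
     \<Union> (set U) = UNIV"

definition part_index :: "nat set list \<Rightarrow> nat \<Rightarrow> nat" where
  "part_index U i = (THE j. j < length U \<and> i \<in> U ! j)"

definition X_points :: "nat set list \<Rightarrow> complex list set \<Rightarrow> (nat \<Rightarrow> complex) set" where
  "X_points U Z = {x. \<exists>z\<in>Z. \<forall>i. x i = z ! part_index U i}"

text \<open>A list \<open>[(i\<^sub>1, k\<^sub>1), \<dots>, (i\<^sub>m, k\<^sub>m)]\<close> encodes the differential operator
  \<open>\<partial>\<^bsub>i\<^sub>1\<^esub>\<^bsup>k\<^sub>1\<^esup> \<dots> \<partial>\<^bsub>i\<^sub>m\<^esub>\<^bsup>k\<^sub>m\<^esup>\<close>.\<close>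

definition partials :: "(nat \<times> nat) list \<Rightarrow> R \<Rightarrow> R" where
  "partials D f = foldr (\<lambda>(i, k). partial i ^^ k) D f"

definition P_ideal :: "enat list \<Rightarrow> nat list \<Rightarrow> complex list set \<Rightarrow> R set" where
  "P_ideal l e Z = {f. \<forall>U x D. partition_of_type l U \<longrightarrow> x \<in> X_points U Z \<longrightarrow>
     distinct (map fst D) \<longrightarrow> (\<forall>(i, k)\<in>set D. k < e ! part_index U i) \<longrightarrow>
     eval x (partials D f) = 0}"

end

theory Submission
  imports Defs "HOL-Computational_Algebra.Fundamental_Theorem_Algebra"
    "HOL-Analysis.Continuum_Not_Denumerable" "HOL-Library.FuncSet"
begin

text \<open>Eliminating the variables of a non-zero element of \<open>P\<close> by Vandermonde determinants puts a power
  of a discriminant into \<open>P\<close>; hence for some \<open>r\<close> a power of the discriminant of any \<open>r + 1\<close>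
  variables lies in \<open>P\<close>, but no power of the discriminant of \<open>r\<close> variables does. Adjoin distinct
  centers \<open>t\<^sub>0, \<dots>, t\<^sub>r\<^sub>-\<^sub>1\<close>, fixed by the group, and extend \<open>P\<close> to an equivariantly prime ideal \<open>Q\<close> that
  lies over \<open>P\<close> and contains a power of \<open>\<Prod>\<^sub>j (\<xi>\<^sub>i - t\<^sub>j)\<close> for every \<open>i\<close>. Modulo \<open>Q\<close> polynomials in the
  centers are zero or cancellable, so \<open>Q\<close> behaves like an ideal in a tensor power of a
  finite-dimensional algebra over a field. Its structure is read off from two numbers for each
  center: the order \<open>e\<^sub>j\<close> of nilpotency of \<open>\<xi>\<^sub>i - t\<^sub>j\<close> near \<open>t\<^sub>j\<close>, and the largest
  number \<open>\<lambda>\<^sub>j\<close> of variables that can be near \<open>t\<^sub>j\<close> at once. Taylor expansion at the centers then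
  describes \<open>P\<close> by derivatives that lie in the prime ideal of polynomials in the centers that
  belong to \<open>Q\<close>, and the Nullstellensatz translates this into vanishing on a variety \<open>Z\<close>.\<close>

section \<open>Substitution homomorphisms\<close>

text \<open>As a simplification rule this is associativity read backwards, which makes
  \<open>algebra_simps\<close> loop on \<open>R\<close>.\<close>

declare ideal.scale_scale [simp del]

text \<open>The obstacle is that \<open>Q\<close> is prime only for the group: modulo
  \<open>Q\<close> the elements \<open>\<xi>\<^sub>i - t\<^sub>j\<close> may be zero divisors or
  nilpotent, so no statement about old variables can be cancelled as in a domain. What replaces
  cancellation is a comparison of a product with its translates. A translate either shares a
  variable with the original, and then nilpotency or the orthogonality of different centers decides
  the outcome, or it is disjoint from it, and then both together form a larger product of the same
  kind, which can be renamed freely. The same dichotomy shows that a center of weight at least 2 has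
  infinite capacity; this is where reducedness of the weight vector comes from. Powers of
  discriminants appear because \<open>P\<close> may fail to be radical. The exponent doubles on the
  way to \<open>Q\<close> because a discriminant over ordered pairs contains each difference twice,
  up to sign. All ideals live in the one ring \<open>R\<close>, so the Nullstellensatz has to cope
  with countably many variables; the uncountability of the complex numbers takes the place of finite
  generation.\<close>

definition ring_hom_fun :: "('a::comm_semiring_1 \<Rightarrow> 'b::comm_semiring_1) \<Rightarrow> bool" where
  "ring_hom_fun h \<longleftrightarrow> h 0 = 0 \<and> h 1 = 1 \<and> (\<forall>a b. h (a + b) = h a + h b) \<and> (\<forall>a b. h (a * b) = h a * h b)"

lemma ring_hom_funD:
  assumes "ring_hom_fun h"
  shows "h 0 = 0" "h 1 = 1" "h (a + b) = h a + h b" "h (a * b) = h a * h b"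
  using assms by (auto simp: ring_hom_fun_def)

lemma ring_hom_fun_power: "ring_hom_fun h \<Longrightarrow> h (a ^ n) = h a ^ n"
  by (induction n) (auto simp: ring_hom_funD)

lemma ring_hom_fun_sum: "ring_hom_fun h \<Longrightarrow> h (sum f A) = (\<Sum>x\<in>A. h (f x))"
  by (induction A rule: infinite_finite_induct) (auto simp: ring_hom_funD)

lemma ring_hom_fun_prod: "ring_hom_fun h \<Longrightarrow> h (prod f A) = (\<Prod>x\<in>A. h (f x))"
  by (induction A rule: infinite_finite_induct) (auto simp: ring_hom_funD)

lemma ring_hom_fun_minus:
  fixes h :: "'a::comm_ring_1 \<Rightarrow> 'b::comm_ring_1"
  assumes "ring_hom_fun h"
  shows "h (a - b) = h a - h b"
proof -
  have "h (a - b) + h b = h a"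
    using ring_hom_funD(3)[OF assms, of "a - b" b] by simp
  then show ?thesis by (simp add: algebra_simps)
qed

lemma ring_hom_fun_const: "ring_hom_fun const"
  by (auto simp: ring_hom_fun_def const_def single_add mult_single)

lemma ring_hom_fun_ident: "ring_hom_fun (\<lambda>c. c)"
  by (auto simp: ring_hom_fun_def)

definition monom_val :: "(nat \<Rightarrow> 'a::comm_semiring_1) \<Rightarrow> monom \<Rightarrow> 'a" where
  "monom_val x m = (\<Prod>i\<in>Poly_Mapping.keys m. x i ^ Poly_Mapping.lookup m i)"

lemma monom_val_superset:
  "finite S \<Longrightarrow> Poly_Mapping.keys m \<subseteq> S \<Longrightarrow> monom_val x m = (\<Prod>i\<in>S. x i ^ Poly_Mapping.lookup m i)"
  unfolding monom_val_def
  by (rule prod.mono_neutral_left) (auto simp: in_keys_iff)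

lemma monom_val_add: "monom_val x (m + n) = monom_val x m * monom_val x n"
proof -
  let ?S = "Poly_Mapping.keys m \<union> Poly_Mapping.keys n"
  have "Poly_Mapping.keys (m + n) \<subseteq> ?S" by (rule Poly_Mapping.keys_add)
  then show ?thesis
    by (simp add: monom_val_superset[of ?S] lookup_add power_add prod.distrib)
qed

lemma subst_superset:
  assumes "finite S" "Poly_Mapping.keys f \<subseteq> S" "h 0 = 0"
  shows "subst h x f = (\<Sum>m\<in>S. h (Poly_Mapping.lookup f m) * monom_val x m)"
  unfolding subst_def monom_val_def[symmetric]
  by (rule sum.mono_neutral_left) (use assms in \<open>auto simp: in_keys_iff\<close>)

lemma subst_single: "h 0 = 0 \<Longrightarrow> subst h x (Poly_Mapping.single m c) = h c * monom_val x m"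
  by (subst subst_superset[where S="{m}"]) (auto simp: lookup_single)

lemma subst_add:
  assumes "ring_hom_fun h"
  shows "subst h x (f + g) = subst h x f + subst h x g"
proof -
  let ?S = "Poly_Mapping.keys f \<union> Poly_Mapping.keys g"
  have "Poly_Mapping.keys (f + g) \<subseteq> ?S" by (rule Poly_Mapping.keys_add)
  then show ?thesis
    using assms
    by (simp add: subst_superset[of ?S] ring_hom_funD[OF assms] lookup_add algebra_simps sum.distrib)
qed

lemma subst_zero: "ring_hom_fun h \<Longrightarrow> subst h x 0 = 0"
  by (simp add: subst_def)

lemma subst_sum: "ring_hom_fun h \<Longrightarrow> subst h x (sum f A) = (\<Sum>a\<in>A. subst h x (f a))"
  by (induction A rule: infinite_finite_induct) (auto simp: subst_add subst_zero)

lemma sum_singles: "(\<Sum>m\<in>Poly_Mapping.keys f. Poly_Mapping.single m (Poly_Mapping.lookup f m)) = f"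
  by (rule poly_mapping_eqI)
    (auto simp: lookup_sum lookup_single when_def in_keys_iff sum.delta)

lemma subst_mult:
  assumes "ring_hom_fun h"
  shows "subst h x (f * g) = subst h x f * subst h x g"
proof -
  have *: "subst h x (Poly_Mapping.single m a * Poly_Mapping.single n b)
    = subst h x (Poly_Mapping.single m a) * subst h x (Poly_Mapping.single n b)" for m n a b
    by (simp add: mult_single subst_single ring_hom_funD[OF assms] monom_val_add ac_simps)
  have "f * g = (\<Sum>m\<in>Poly_Mapping.keys f. \<Sum>n\<in>Poly_Mapping.keys g.
     Poly_Mapping.single m (Poly_Mapping.lookup f m) * Poly_Mapping.single n (Poly_Mapping.lookup g n))"
    by (subst (1) sum_singles[of f, symmetric], subst (1) sum_singles[of g, symmetric])
      (simp add: sum_product)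
  then have "subst h x (f * g) = (\<Sum>m\<in>Poly_Mapping.keys f. subst h x (Poly_Mapping.single m (Poly_Mapping.lookup f m)))
      * (\<Sum>n\<in>Poly_Mapping.keys g. subst h x (Poly_Mapping.single n (Poly_Mapping.lookup g n)))"
    by (simp add: subst_sum[OF assms] * sum_product)
  then show ?thesis
    by (simp add: subst_sum[OF assms, symmetric] sum_singles)
qed

lemma subst_const: "ring_hom_fun h \<Longrightarrow> subst h x (const c) = h c"
  by (simp add: const_def subst_single ring_hom_funD monom_val_def)

lemma subst_var: "ring_hom_fun h \<Longrightarrow> subst h x (var i) = x i"
  by (simp add: var_def subst_single ring_hom_funD monom_val_def)

lemma ring_hom_fun_subst: "ring_hom_fun h \<Longrightarrow> ring_hom_fun (subst h x)"
  using subst_const[of h x 1]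
  by (auto simp: ring_hom_fun_def subst_add subst_mult subst_zero const_def)

text \<open>The composition laws \<open>act_act\<close> and \<open>eval_act\<close> and the
  evaluation \<open>poly_to_poly\<close> are all instances of this.\<close>

lemma hom_subst:
  assumes "ring_hom_fun \<phi>"
  shows "\<phi> (subst h x f) = subst (\<lambda>c. \<phi> (h c)) (\<lambda>i. \<phi> (x i)) f"
  unfolding subst_def
  by (simp add: ring_hom_fun_sum[OF assms] ring_hom_funD[OF assms] ring_hom_fun_prod[OF assms]
      ring_hom_fun_power[OF assms])

lemma monom_val_cong: "(\<And>i. i \<in> Poly_Mapping.keys m \<Longrightarrow> x i = y i) \<Longrightarrow> monom_val x m = monom_val y m"
  unfolding monom_val_def by (intro prod.cong) auto

lemma subst_cong:
  assumes "\<And>i. i \<in> vars f \<Longrightarrow> x i = y i"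
  shows "subst h x f = subst h y f"
  unfolding subst_def monom_val_def[symmetric]
  using assms by (intro sum.cong refl arg_cong2[where f="(*)"] monom_val_cong) (auto simp: vars_def)

lemma monom_val_var: "monom_val var m = Poly_Mapping.single m 1"
proof -
  have p: "var i ^ k = Poly_Mapping.single (Poly_Mapping.single i k) 1" for i k
    by (induction k) (auto simp: var_def mult_single single_add[symmetric])
  have "finite S \<Longrightarrow> (\<Prod>i\<in>S. Poly_Mapping.single (Poly_Mapping.single i (Poly_Mapping.lookup m i)) 1)
     = (Poly_Mapping.single (\<Sum>i\<in>S. Poly_Mapping.single i (Poly_Mapping.lookup m i)) 1 :: R)" for S
    by (induction S rule: finite_induct) (auto simp: mult_single)
  then show ?thesis
    unfolding monom_val_def p by (simp add: sum_singles)
qed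

lemma subst_const_var: "subst const var f = f"
  unfolding subst_def monom_val_def[symmetric] monom_val_var
  by (simp add: const_def mult_single sum_singles)

text \<open>Every polynomial is its own image when the variables are substituted for themselves, and
  that image is visibly built from constants and variables.\<close>

lemma R_induct [case_names const var add mult]:
  assumes "\<And>c. Q (const c)" "\<And>i. Q (var i)" "\<And>f g. Q f \<Longrightarrow> Q g \<Longrightarrow> Q (f + g)"
    "\<And>f g. Q f \<Longrightarrow> Q g \<Longrightarrow> Q (f * g)"
  shows "Q f"
proof -
  have 0: "Q 0" using assms(1)[of 0] by (simp add: const_def)
  have 1: "Q 1" using assms(1)[of 1] by (simp add: const_def)
  have pw: "Q g \<Longrightarrow> Q (g ^ n)" for g n
    by (induction n) (auto simp: 1 assms(4))
  have pr: "(\<And>i. i \<in> A \<Longrightarrow> Q (g i)) \<Longrightarrow> Q (prod g A)" for g and A :: "nat set"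
    by (induction A rule: infinite_finite_induct) (auto simp: 1 assms(4))
  have sm: "(\<And>i. i \<in> A \<Longrightarrow> Q (g i)) \<Longrightarrow> Q (sum g A)" for g and A :: "monom set"
    by (induction A rule: infinite_finite_induct) (auto simp: 0 assms(3))
  have "Q (subst const var f)"
    unfolding subst_def by (intro sm assms(4) pr pw assms(1,2))
  then show ?thesis by (simp add: subst_const_var)
qed

lemma finite_vars: "finite (vars f)"
  by (simp add: vars_def)

lemma vars_const [simp]: "vars (const c) = {}"
  by (auto simp: vars_def const_def)

lemma vars_one [simp]: "vars 1 = {}"
  by (simp add: vars_def)

lemma vars_var [simp]: "vars (var i) = {i}"
  by (auto simp: vars_def var_def)

lemma vars_add: "vars (f + g) \<subseteq> vars f \<union> vars g"
  using Poly_Mapping.keys_add[of f g] by (auto simp: vars_def)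

lemma vars_minus: "vars (f - g) \<subseteq> vars f \<union> vars g"
  using Poly_Mapping.keys_diff[of f g] by (auto simp: vars_def)

lemma vars_mult: "vars (f * g) \<subseteq> vars f \<union> vars g"
proof
  fix i assume "i \<in> vars (f * g)"
  then obtain m where m: "m \<in> Poly_Mapping.keys (f * g)" "i \<in> Poly_Mapping.keys m"
    by (auto simp: vars_def)
  then obtain a b where "a \<in> Poly_Mapping.keys f" "b \<in> Poly_Mapping.keys g" "m = a + b"
    using Poly_Mapping.keys_mult[of f g] by blast
  then show "i \<in> vars f \<union> vars g"
    using m Poly_Mapping.keys_add[of a b] by (auto simp: vars_def)
qed

lemma vars_power: "vars (f ^ n) \<subseteq> vars f"
proof (induction n)
  case (Suc n)
  then show ?case using vars_mult[of f "f ^ n"] by auto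
qed simp

lemma vars_prod: "vars (prod g A) \<subseteq> (\<Union>a\<in>A. vars (g a))"
proof (induction A rule: infinite_finite_induct)
  case (insert x F)
  then show ?case using vars_mult[of "g x" "prod g F"] by auto
qed auto

lemma vars_sum: "vars (sum g A) \<subseteq> (\<Union>a\<in>A. vars (g a))"
proof (induction A rule: infinite_finite_induct)
  case (insert x F)
  then show ?case using vars_add[of "g x" "sum g F"] by auto
qed (auto simp: vars_def)

lemma vars_subst_const: "vars (subst const x f) \<subseteq> (\<Union>i\<in>vars f. vars (x i))"
proof -
  have "vars (const (Poly_Mapping.lookup f m) * monom_val x m) \<subseteq> (\<Union>i\<in>vars f. vars (x i))"
    if "m \<in> Poly_Mapping.keys f" for m
  proof -
    have "vars (monom_val x m) \<subseteq> (\<Union>i\<in>Poly_Mapping.keys m. vars (x i))"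
      unfolding monom_val_def by (rule order_trans[OF vars_prod UN_mono[OF order_refl vars_power]])
    moreover have "Poly_Mapping.keys m \<subseteq> vars f" using that by (auto simp: vars_def)
    ultimately show ?thesis
      using vars_mult[of "const (Poly_Mapping.lookup f m)" "monom_val x m"]
      unfolding vars_const by blast
  qed
  then show ?thesis
    unfolding subst_def monom_val_def[symmetric]
    by (intro order_trans[OF vars_sum] UN_least)
qed

section \<open>Renaming of variables and evaluation at points\<close>

lemma ring_hom_act: "ring_hom_fun (act s)"
  unfolding act_def by (rule ring_hom_fun_subst) (rule ring_hom_fun_const)

lemmas act_simps [simp] =
  ring_hom_funD[OF ring_hom_act] ring_hom_fun_minus[OF ring_hom_act]
  ring_hom_fun_power[OF ring_hom_act] ring_hom_fun_prod[OF ring_hom_act]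
  ring_hom_fun_sum[OF ring_hom_act]

lemma act_const [simp]: "act s (const c) = const c"
  and act_var [simp]: "act s (var i) = var (s i)"
  unfolding act_def by (simp_all add: subst_const subst_var ring_hom_fun_const)

lemma act_act: "act s (act t f) = act (\<lambda>i. s (t i)) f"
  unfolding act_def[of t] hom_subst[OF ring_hom_act]
  by (simp add: act_def[of "\<lambda>i. s (t i)"])

lemma act_cong: "(\<And>i. i \<in> vars f \<Longrightarrow> s i = t i) \<Longrightarrow> act s f = act t f"
  unfolding act_def by (rule subst_cong) simp

lemma act_ident: "(\<And>i. i \<in> vars f \<Longrightarrow> s i = i) \<Longrightarrow> act s f = f"
  using act_cong[of f s "\<lambda>i. i"] by (simp add: act_def subst_const_var)

lemma vars_act: "vars (act s f) \<subseteq> s ` vars f"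
  unfolding act_def using vars_subst_const[of "\<lambda>i. var (s i)" f] by auto

lemma ring_hom_eval: "ring_hom_fun (eval x)"
  unfolding eval_def by (rule ring_hom_fun_subst) (rule ring_hom_fun_ident)

lemmas eval_simps [simp] =
  ring_hom_funD[OF ring_hom_eval] ring_hom_fun_minus[OF ring_hom_eval]
  ring_hom_fun_power[OF ring_hom_eval] ring_hom_fun_prod[OF ring_hom_eval]
  ring_hom_fun_sum[OF ring_hom_eval]

lemma eval_const [simp]: "eval x (const c) = c"
  and eval_var [simp]: "eval x (var i) = x i"
  unfolding eval_def by (simp_all add: subst_const subst_var ring_hom_fun_ident)

lemma eval_act: "eval x (act s f) = eval (\<lambda>i. x (s i)) f"
  unfolding act_def hom_subst[OF ring_hom_eval] by (simp add: eval_def[of "\<lambda>i. x (s i)"])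

lemma eval_cong: "(\<And>i. i \<in> vars f \<Longrightarrow> x i = y i) \<Longrightarrow> eval x f = eval y f"
  unfolding eval_def by (rule subst_cong) simp

lemma const_simps: "const 0 = 0" "const 1 = 1" "const (a + b) = const a + const b"
    "const (a * b) = const a * const b" "const (a - b) = const a - const b"
  using ring_hom_funD[OF ring_hom_fun_const] ring_hom_fun_minus[OF ring_hom_fun_const] by blast+

lemma const_inverse: "a \<noteq> 0 \<Longrightarrow> const (inverse a) * const a = 1"
  by (simp add: const_simps(4)[symmetric] const_simps(2))

section \<open>A Nullstellensatz in countably many variables\<close>

lemma ideal_mult:
  assumes "ideal.subspace I" "a \<in> I"
  shows "a * b \<in> I" "b * a \<in> I"
  using ideal.subspace_scale[OF assms, of b] by (simp_all add: mult.commute)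

lemma ideal_dvd: "ideal.subspace I \<Longrightarrow> a \<in> I \<Longrightarrow> a dvd b \<Longrightarrow> b \<in> I"
  by (auto simp: ideal_mult elim!: dvdE)

lemma ideal_cong:
  assumes "ideal.subspace I" "a - b \<in> I"
  shows "a \<in> I \<longleftrightarrow> b \<in> I"
  using ideal.subspace_diff[OF assms(1) _ assms(2), of a] ideal.subspace_add[OF assms(1,2), of b] by auto

lemma ideal_span_insert_subspace:
  assumes "ideal.subspace I"
  shows "ideal.span (insert a I) = {x. \<exists>k. x - k * a \<in> I}"
proof -
  have *: "ideal.span I = I" using assms by simp
  show ?thesis using ideal.span_insert[of a I] unfolding * .
qed

lemma ideal_Union_chain:
  assumes "C \<noteq> {}" "subset.chain \<A> C" "\<And>I. I \<in> C \<Longrightarrow> ideal.subspace I"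
  shows "ideal.subspace (\<Union>C)"
proof (rule ideal.subspaceI)
  show "0 \<in> \<Union>C" using assms(1,3) ideal.subspace_0 by blast
  show "c * x \<in> \<Union>C" if "x \<in> \<Union>C" for c x
    using that assms(3) ideal.subspace_scale by blast
  show "x + y \<in> \<Union>C" if "x \<in> \<Union>C" "y \<in> \<Union>C" for x y
  proof -
    obtain I J where "I \<in> C" "J \<in> C" "x \<in> I" "y \<in> J" using \<open>x \<in> \<Union>C\<close> \<open>y \<in> \<Union>C\<close> by blast
    moreover then have "I \<subseteq> J \<or> J \<subseteq> I"
      using assms(2) by (auto simp: subset_chain_def)
    ultimately show ?thesis
      using assms(3) by (metis Union_iff ideal.subspace_add subsetD)
  qed
qed

definition univ_in :: "nat \<Rightarrow> complex poly \<Rightarrow> R" where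
  "univ_in j p = poly (map_poly const p) (var j)"

lemma ring_hom_univ_in: "ring_hom_fun (univ_in j)"
proof -
  have "map_poly const (p + q) = map_poly const p + map_poly const q"
    "map_poly const (p * q) = map_poly const p * map_poly const q" for p q
    by (rule poly_eqI; simp add: coeff_map_poly const_simps coeff_mult
        ring_hom_fun_sum[OF ring_hom_fun_const])+
  then show ?thesis
    by (auto simp: ring_hom_fun_def univ_in_def const_simps map_poly_1)
qed

lemma univ_in_pCons: "univ_in j [:c:] = const c" "univ_in j [:-c, 1:] = var j - const c"
  using ring_hom_fun_minus[OF ring_hom_fun_const, of 0 c]
  by (auto simp: univ_in_def const_simps map_poly_pCons)

text \<open>The complex numbers are algebraically closed: split off one root at a time, and
  primality puts some linear factor into \<open>m\<close>.\<close>

lemma univ_in_linear_factor: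
  assumes I: "ideal.subspace m" and pr: "\<And>a b. a * b \<in> m \<Longrightarrow> a \<in> m \<or> b \<in> m" and 1: "1 \<notin> m"
    and "p \<noteq> 0" "univ_in j p \<in> m"
  shows "\<exists>c. var j - const c \<in> m"
  using assms(4,5)
proof (induction "degree p" arbitrary: p rule: less_induct)
  case less
  show ?case
  proof (cases "degree p = 0")
    case True
    then obtain a where "p = [:a:]" by (metis degree_eq_zeroE)
    then have "a \<noteq> 0" "const a \<in> m" using less by (auto simp: univ_in_pCons)
    then show ?thesis using 1 ideal_mult(2)[OF I, of "const a" "const (inverse a)"] const_inverse by simp
  next
    case False
    then obtain z where "poly p z = 0"
      by (metis fundamental_theorem_of_algebra constant_degree)
    then obtain q where q: "p = [:-z, 1:] * q"
      by (metis dvdE poly_eq_0_iff_dvd)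
    then have "(var j - const z) * univ_in j q \<in> m"
      using less.prems by (metis ring_hom_funD(4)[OF ring_hom_univ_in] univ_in_pCons(2))
    then consider "var j - const z \<in> m" | "univ_in j q \<in> m" using pr by blast
    then show ?thesis
    proof cases
      case 2
      have "q \<noteq> 0" using less.prems q by auto
      then have "degree q < degree p" unfolding q by (subst degree_mult_eq) auto
      then show ?thesis using less.hyps \<open>q \<noteq> 0\<close> 2 by blast
    qed blast
  qed
qed

text \<open>A countable exhaustion of the monomials by finite sets; in this form the countable
  dimension of \<open>R\<close> enters the Nullstellensatz.\<close>

definition box_monoms :: "nat \<Rightarrow> monom set" where
  "box_monoms n = {m. Poly_Mapping.keys m \<subseteq> {..<n} \<and> (\<forall>i. Poly_Mapping.lookup m i \<le> n)}"

lemma finite_box_monoms: "finite (box_monoms n)"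
proof (rule finite_subset)
  let ?G = "\<lambda>f. \<Sum>i<n. Poly_Mapping.single i (f i)"
  show "finite (?G ` (\<Pi>\<^sub>E i\<in>{..<n}. {..n}))"
    by (intro finite_imageI finite_PiE) auto
  show "box_monoms n \<subseteq> ?G ` (\<Pi>\<^sub>E i\<in>{..<n}. {..n})"
  proof
    fix m assume m: "m \<in> box_monoms n"
    let ?f = "restrict (Poly_Mapping.lookup m) {..<n}"
    have "Poly_Mapping.lookup m k = 0" if "\<not> k < n" for k
      using that m by (auto simp: box_monoms_def in_keys_iff)
    then have "m = ?G ?f"
      by (intro poly_mapping_eqI) (simp add: lookup_sum lookup_single when_def)
    moreover have "?f \<in> (\<Pi>\<^sub>E i\<in>{..<n}. {..n})" using m by (auto simp: box_monoms_def)
    ultimately show "m \<in> ?G ` (\<Pi>\<^sub>E i\<in>{..<n}. {..n})" by blast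
  qed
qed

lemma keys_subset_box: "\<exists>n. Poly_Mapping.keys (f :: R) \<subseteq> box_monoms n"
proof -
  have single: "\<exists>n. m \<in> box_monoms n" for m
  proof -
    obtain a where a: "Poly_Mapping.keys m \<subseteq> {..<a}"
      using finite_nat_iff_bounded[of "Poly_Mapping.keys m"] by auto
    have "Poly_Mapping.lookup m i \<le> (\<Sum>j\<in>Poly_Mapping.keys m. Poly_Mapping.lookup m j)" for i
      by (cases "i \<in> Poly_Mapping.keys m") (auto intro: member_le_sum simp: in_keys_iff)
    then show ?thesis using a
      by (intro exI[of _ "a + (\<Sum>j\<in>Poly_Mapping.keys m. Poly_Mapping.lookup m j)"])
        (auto simp: box_monoms_def intro: trans_le_add2)
  qed
  have mono: "a \<le> b \<Longrightarrow> box_monoms a \<subseteq> box_monoms b" for a b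
    by (auto simp: box_monoms_def) (meson order_trans)
  have "finite A \<Longrightarrow> \<exists>n. A \<subseteq> box_monoms n" for A
  proof (induction A rule: finite_induct)
    case (insert m A)
    then obtain n n' where "A \<subseteq> box_monoms n" "m \<in> box_monoms n'" using single by blast
    then show ?case
      using mono[of n "max n n'"] mono[of n' "max n n'"] by (intro exI[of _ "max n n'"]) auto
  qed auto
  then show ?thesis by simp
qed

text \<open>A residue field of \<open>R\<close> has countable dimension over the uncountable field of complex numbers,
  so it cannot contain a transcendental \<open>x\<close>: the inverses of \<open>x - c\<close> would be linearly
  independent. Below, \<open>m\<close> plays the role of a maximal ideal of the localisation at \<open>g\<close>.\<close>

lemma residue_coordinate:
  assumes I: "ideal.subspace m" and pr: "\<And>a b. a * b \<in> m \<Longrightarrow> a \<in> m \<or> b \<in> m" and g: "\<And>k. g ^ k \<notin> m"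
    and mx: "\<And>a. a \<notin> m \<Longrightarrow> \<exists>k h. g ^ k - h * a \<in> m"
  shows "\<exists>c. var j - const c \<in> m"
proof (rule ccontr)
  assume "\<nexists>c. var j - const c \<in> m"
  then have nm: "var j - const c \<notin> m" for c by blast
  then have "\<forall>c. \<exists>k h. g ^ k - h * (var j - const c) \<in> m" using mx by blast
  then obtain K H where KH: "\<And>c. g ^ K c - H c * (var j - const c) \<in> m" by metis
  have "\<forall>c. \<exists>n. Poly_Mapping.keys (H c) \<subseteq> box_monoms n" using keys_subset_box by blast
  then obtain N where N: "\<And>c. Poly_Mapping.keys (H c) \<subseteq> box_monoms (N c)" by metis
  \<comment> \<open>There are uncountably many \<open>c\<close> but only countably many pairs, so
    one pair serves infinitely many \<open>c\<close>. For these the inverses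
    \<open>H c / g ^ k\<close> of \<open>\<xi>\<^sub>j - c\<close> all lie in one finite-dimensional
    space.\<close>
  have "\<exists>k n. infinite {c. K c = k \<and> N c = n}"
  proof (rule ccontr)
    assume "\<nexists>k n. infinite {c. K c = k \<and> N c = n}"
    then have "countable (\<Union>(k, n)\<in>UNIV. {c. K c = k \<and> N c = n})"
      by (intro countable_UN) (auto intro: countable_finite)
    moreover have "(\<Union>(k, n)\<in>UNIV. {c. K c = k \<and> N c = n}) = UNIV" by auto
    ultimately show False using uncountable_UNIV_complex by simp
  qed
  then obtain k n where inf: "infinite {c. K c = k \<and> N c = n}" by blast
  define S where "S = {c. K c = k \<and> N c = n}"
  have inj: "inj_on H S"
  proof (rule inj_onI, rule ccontr)
    fix c d assume cd: "c \<in> S" "d \<in> S" "H c = H d" "c \<noteq> d"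
    have "(g ^ k - H c * (var j - const d)) - (g ^ k - H c * (var j - const c)) \<in> m"
      by (rule ideal.subspace_diff[OF I]) (use KH[of c] KH[of d] cd in \<open>auto simp: S_def\<close>)
    then have "H c * const (d - c) \<in> m" by (simp add: algebra_simps const_simps)
    moreover have "const (d - c) \<notin> m"
      using ideal_mult(2)[OF I, of "const (d - c)" "const (inverse (d - c))"] const_inverse[of "d - c"] cd(4) g[of 0]
      by auto
    ultimately have "H c * (var j - const c) \<in> m" using pr ideal_mult[OF I] by blast
    then show False using ideal_cong[OF I KH[of c]] g by blast
  qed
  interpret v: vector_space "\<lambda>c (f :: R). const c * f"
    by unfold_locales (simp_all add: const_simps algebra_simps)
  let ?B = "(\<lambda>m. Poly_Mapping.single m 1 :: R) ` box_monoms n"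
  have "H ` S \<subseteq> v.span ?B"
  proof safe
    fix c assume "c \<in> S"
    then have keys: "Poly_Mapping.keys (H c) \<subseteq> box_monoms n" using N[of c] by (auto simp: S_def)
    have "H c = (\<Sum>m\<in>Poly_Mapping.keys (H c). const (Poly_Mapping.lookup (H c) m) * Poly_Mapping.single m 1)"
      by (simp add: const_def mult_single sum_singles)
    also have "\<dots> \<in> v.span ?B"
      by (intro v.span_sum v.span_scale v.span_base) (use keys in auto)
    finally show "H c \<in> v.span ?B" .
  qed
  then have "v.dependent (H ` S)"
    using v.independent_span_bound[of ?B "H ` S"] finite_box_monoms inf inj
    by (auto simp: S_def[symmetric] finite_image_iff)
  then obtain t u where t: "finite t" "t \<subseteq> H ` S" "(\<Sum>v\<in>t. const (u v) * v) = 0" "\<exists>v\<in>t. u v \<noteq> 0"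
    unfolding v.dependent_explicit by blast
  then obtain C where C: "C \<subseteq> S" "inj_on H C" "t = H ` C" by (auto simp: subset_image_inj)
  then have finC: "finite C" using t(1) by (simp add: finite_image_iff)
  have rel: "(\<Sum>c\<in>C. const (u (H c)) * H c) = 0"
    using t(3) C by (simp add: sum.reindex)
  obtain c0 where c0: "c0 \<in> C" "u (H c0) \<noteq> 0" using t(4) C by auto
  \<comment> \<open>The numerator of the sum of \<open>u (H c) / (X - c)\<close> over the common
    denominator; at \<open>c0\<close> only the summand of \<open>c0\<close> survives.\<close>
  define p where "p = (\<Sum>c\<in>C. [:u (H c):] * (\<Prod>d\<in>C - {c}. [:-d, 1:]))"
  have "poly p c0 = (\<Sum>c\<in>C. u (H c) * (\<Prod>d\<in>C - {c}. c0 - d))"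
    by (simp add: p_def poly_sum poly_prod)
  also have "\<dots> = (\<Sum>c\<in>{c0}. u (H c) * (\<Prod>d\<in>C - {c}. c0 - d))"
    by (rule sum.mono_neutral_right) (use finC c0 in auto)
  finally have "poly p c0 \<noteq> 0" using c0 finC by auto
  then have p0: "p \<noteq> 0" by auto
  let ?L = "\<lambda>d. var j - const d"
  have E: "univ_in j p = (\<Sum>c\<in>C. const (u (H c)) * (\<Prod>d\<in>C - {c}. ?L d))"
    unfolding p_def
    by (simp only: ring_hom_fun_sum[OF ring_hom_univ_in] ring_hom_fun_prod[OF ring_hom_univ_in]
        ring_hom_funD(4)[OF ring_hom_univ_in] univ_in_pCons)
  \<comment> \<open>Replacing \<open>g ^ k\<close> by \<open>H c * ?L c\<close> in each summand
    costs an element of \<open>m\<close>; what remains is the linear relation times the full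
    product.\<close>
  have "g ^ k * univ_in j p
      = (\<Sum>c\<in>C. const (u (H c)) * (\<Prod>d\<in>C - {c}. ?L d) * (g ^ k - H c * ?L c)
           + const (u (H c)) * H c * (\<Prod>d\<in>C. ?L d))"
    unfolding E sum_distrib_left
    by (rule sum.cong[OF refl]) (simp add: prod.remove[OF finC] algebra_simps)
  also have "\<dots> = (\<Sum>c\<in>C. const (u (H c)) * (\<Prod>d\<in>C - {c}. ?L d) * (g ^ k - H c * ?L c))"
    by (simp only: sum.distrib sum_distrib_right[symmetric] rel) simp
  also have "\<dots> \<in> m"
    by (intro ideal.subspace_sum[OF I] ideal_mult(2)[OF I]) (use C KH in \<open>auto simp: S_def\<close>)
  finally have "univ_in j p \<in> m" using pr g by blast
  then show False using univ_in_linear_factor[OF I pr _ p0] g[of 0] nm by auto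
qed

text \<open>An ideal maximal among those that contain \<open>q\<close> and no power of
  \<open>g\<close> corresponds to a maximal ideal of the localisation at \<open>g\<close>. It is
  prime, every variable is constant modulo it, and these constants are the coordinates of the
  point.\<close>

theorem nullstellensatz:
  assumes q: "ideal.subspace q" and g: "\<And>k. g ^ k \<notin> q"
  obtains x where "\<And>h. h \<in> q \<Longrightarrow> eval x h = 0" "eval x g \<noteq> 0"
proof -
  define \<A> where "\<A> = {m. ideal.subspace m \<and> q \<subseteq> m \<and> (\<forall>k. g ^ k \<notin> m)}"
  have "\<exists>m\<in>\<A>. \<forall>X\<in>\<A>. m \<subseteq> X \<longrightarrow> X = m"
  proof (rule subset_Zorn_nonempty)
    show "\<A> \<noteq> {}" using q g by (auto simp: \<A>_def)
    show "\<Union>C \<in> \<A>" if "C \<noteq> {}" "subset.chain \<A> C" for C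
      using ideal_Union_chain[OF that] that by (fastforce simp: \<A>_def subset_chain_def)
  qed
  then obtain m where m: "m \<in> \<A>" and max: "\<And>X. X \<in> \<A> \<Longrightarrow> m \<subseteq> X \<Longrightarrow> X = m" by blast
  have I: "ideal.subspace m" and gm: "\<And>k. g ^ k \<notin> m" and qm: "q \<subseteq> m" using m by (auto simp: \<A>_def)
  have mx: "\<exists>k h. g ^ k - h * a \<in> m" if "a \<notin> m" for a
  proof (rule ccontr)
    assume no: "\<nexists>k h. g ^ k - h * a \<in> m"
    have "ideal.span (insert a m) \<in> \<A>"
      using no qm ideal.span_superset[of "insert a m"]
      by (auto simp: \<A>_def ideal_span_insert_subspace[OF I])
        (use ideal_span_insert_subspace[OF I, of a] ideal.subspace_span[of "insert a m"] in auto)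
    then show False using max[of "ideal.span (insert a m)"] ideal.span_superset[of "insert a m"] that by blast
  qed
  have pr: "a \<in> m \<or> b \<in> m" if "a * b \<in> m" for a b
  proof (rule ccontr)
    assume "\<not> ?thesis"
    then obtain i h j h' where ij: "g ^ i - h * a \<in> m" "g ^ j - h' * b \<in> m" using mx by blast
    then have "(g ^ i - h * a) * g ^ j + (g ^ j - h' * b) * (h * a) + a * b * (h * h') \<in> m"
      by (intro ideal.subspace_add[OF I] ideal_mult(1)[OF I ij(1)] ideal_mult(1)[OF I ij(2)]
          ideal_mult(1)[OF I that])
    also have "(g ^ i - h * a) * g ^ j + (g ^ j - h' * b) * (h * a) + a * b * (h * h') = g ^ (i + j)"
      by (simp add: algebra_simps power_add)
    finally show False using gm by blast
  qed
  have "\<forall>j. \<exists>c. var j - const c \<in> m" using residue_coordinate[OF I pr gm mx] by blast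
  then obtain x where x: "\<And>j. var j - const (x j) \<in> m" by metis
  have ev: "f - const (eval x f) \<in> m" for f
  proof (induction f rule: R_induct)
    case (const c)
    then show ?case using ideal.subspace_0[OF I] by simp
  next
    case (var i)
    then show ?case using x by simp
  next
    case (add f g)
    from ideal.subspace_add[OF I this] show ?case by (simp add: const_simps algebra_simps)
  next
    case (mult f g)
    have "(f - const (eval x f)) * g + (g - const (eval x g)) * const (eval x f) \<in> m"
      by (intro ideal.subspace_add[OF I] ideal_mult[OF I] mult)
    then show ?case by (simp add: const_simps algebra_simps)
  qed
  show ?thesis
  proof (rule that)
    fix h assume "h \<in> q"
    then have c: "const (eval x h) \<in> m" using ev[of h] ideal_cong[OF I] qm by blast
    show "eval x h = 0"
    proof (rule ccontr)
      assume "eval x h \<noteq> 0"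
      then show False using ideal_mult(2)[OF I c, of "const (inverse (eval x h))"] const_inverse gm[of 0] by simp
    qed
  next
    show "eval x g \<noteq> 0" using ev[of g] gm[of 1] by (auto simp: const_simps)
  qed
qed

section \<open>Taylor expansion\<close>

lemma partial_superset:
  assumes "finite S" "Poly_Mapping.keys f \<subseteq> S"
  shows "partial i f = (\<Sum>m\<in>S. Poly_Mapping.single (m - Poly_Mapping.single i 1)
    (of_nat (Poly_Mapping.lookup m i) * Poly_Mapping.lookup f m))"
  unfolding partial_def
  by (rule sum.mono_neutral_left) (use assms in \<open>auto simp: in_keys_iff\<close>)

lemma partial_add: "partial i (f + g) = partial i f + partial i g"
proof -
  let ?S = "Poly_Mapping.keys f \<union> Poly_Mapping.keys g"
  have "Poly_Mapping.keys (f + g) \<subseteq> ?S" by (rule Poly_Mapping.keys_add)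
  then show ?thesis
    by (simp add: partial_superset[of ?S] lookup_add distrib_left single_add sum.distrib)
qed

lemma partial_single: "partial i (Poly_Mapping.single m c)
    = Poly_Mapping.single (m - Poly_Mapping.single i 1) (of_nat (Poly_Mapping.lookup m i) * c)"
  by (subst partial_superset[where S="{m}"]) auto

lemma vars_partial: "vars (partial i f) \<subseteq> vars f"
proof -
  have "vars (Poly_Mapping.single (m - Poly_Mapping.single i 1)
     (of_nat (Poly_Mapping.lookup m i) * Poly_Mapping.lookup f m)) \<subseteq> vars f"
    if "m \<in> Poly_Mapping.keys f" for m
    using that by (auto simp: vars_def in_keys_iff lookup_minus split: if_splits)
  then show ?thesis unfolding partial_def by (intro order_trans[OF vars_sum] UN_least)
qed

lemma partials_simps [simp]: "partials [] f = f" "partials ((i, k) # D) f = (partial i ^^ k) (partials D f)"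
  by (simp_all add: partials_def)

lemma partial_pow_add: "(partial i ^^ k) (f + g) = (partial i ^^ k) f + (partial i ^^ k) g"
  by (induction k) (auto simp: partial_add)

lemma partials_add: "partials D (f + g) = partials D f + partials D g"
  by (induction D) (auto simp: partial_pow_add)

lemma partials_zero: "partials D 0 = 0"
  using partials_add[of D 0 0] by simp

lemma partials_sum: "partials D (sum f A) = (\<Sum>a\<in>A. partials D (f a))"
  by (induction A rule: infinite_finite_induct) (auto simp: partials_add partials_zero)

lemma vars_partials: "vars (partials D f) \<subseteq> vars f"
proof (induction D)
  case (Cons p D)
  have "vars ((partial i ^^ k) g) \<subseteq> vars g" for i k g
    by (induction k) (use vars_partial in \<open>auto intro: order_trans\<close>)
  then have "vars ((partial i ^^ k) (partials D f)) \<subseteq> vars f" for i k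
    using Cons by (rule order_trans)
  then show ?case by (cases p) simp
qed simp

text \<open>The coefficient is a falling factorial. It vanishes when the exponent is less than
  \<open>k\<close>, so truncated subtraction of exponents does no harm.\<close>

lemma partial_pow_single: "(partial i ^^ k) (Poly_Mapping.single m c)
    = Poly_Mapping.single (m - Poly_Mapping.single i k) (of_nat (fact k * (Poly_Mapping.lookup m i choose k)) * c)"
proof (induction k)
  case (Suc k)
  let ?n = "Poly_Mapping.lookup m i"
  have "(?n - k) * (fact k * (?n choose k)) = fact k * ((?n - k) * (?n choose k))" by simp
  also have "\<dots> = fact k * (Suc k * (?n choose Suc k))"
    by (simp only: binomial_absorb_comp binomial_absorption diff_Suc_1')
  finally have c: "(?n - k) * (fact k * (?n choose k)) = fact (Suc k) * (?n choose Suc k)"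
    by (simp add: algebra_simps)
  have m: "m - Poly_Mapping.single i k - Poly_Mapping.single i 1 = m - Poly_Mapping.single i (Suc k)"
    by (rule poly_mapping_eqI) (simp add: lookup_minus lookup_single when_def)
  have "(partial i ^^ Suc k) (Poly_Mapping.single m c) = Poly_Mapping.single
      (m - Poly_Mapping.single i k - Poly_Mapping.single i 1)
      (of_nat (?n - k) * (of_nat (fact k * (?n choose k)) * c))"
    unfolding funpow.simps comp_def Suc partial_single by (simp add: lookup_minus)
  also have "of_nat (?n - k) * (of_nat (fact k * (?n choose k)) * c)
      = of_nat ((?n - k) * (fact k * (?n choose k))) * c"
    by (simp only: of_nat_mult mult.assoc)
  finally show ?case unfolding m c .
qed simp

lemma partials_single:
  assumes "distinct xs"
  shows "partials (map (\<lambda>i. (i, \<alpha> i)) xs) (Poly_Mapping.single m c)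
    = Poly_Mapping.single (m - (\<Sum>i\<in>set xs. Poly_Mapping.single i (\<alpha> i)))
       ((\<Prod>i\<in>set xs. of_nat (fact (\<alpha> i) * (Poly_Mapping.lookup m i choose \<alpha> i))) * c)"
  using assms
proof (induction xs)
  case (Cons j xs)
  let ?m = "m - (\<Sum>i\<in>set xs. Poly_Mapping.single i (\<alpha> i))"
  have l: "Poly_Mapping.lookup ?m j = Poly_Mapping.lookup m j"
    using Cons.prems by (auto simp: lookup_minus lookup_sum lookup_single when_def)
  have "?m - Poly_Mapping.single j (\<alpha> j) = m - (\<Sum>i\<in>set (j # xs). Poly_Mapping.single i (\<alpha> i))"
    using Cons.prems by (intro poly_mapping_eqI) (simp add: lookup_minus lookup_add)
  then show ?case using Cons by (simp add: partial_pow_single l mult.assoc)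
qed simp

definition multi_partial :: "nat set \<Rightarrow> (nat \<Rightarrow> nat) \<Rightarrow> R \<Rightarrow> R" where
  "multi_partial V \<alpha> f = partials (map (\<lambda>i. (i, \<alpha> i)) (sorted_list_of_set V)) f"

lemma multi_partial_single:
  assumes "finite V"
  shows "multi_partial V \<alpha> (Poly_Mapping.single m c)
    = Poly_Mapping.single (m - (\<Sum>i\<in>V. Poly_Mapping.single i (\<alpha> i)))
       ((\<Prod>i\<in>V. of_nat (fact (\<alpha> i) * (Poly_Mapping.lookup m i choose \<alpha> i))) * c)"
  using partials_single[of "sorted_list_of_set V"] assms unfolding multi_partial_def by simp

lemma multi_partial_sum: "multi_partial V \<alpha> (sum f A) = (\<Sum>a\<in>A. multi_partial V \<alpha> (f a))"
  by (simp add: multi_partial_def partials_sum)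

lemma vars_multi_partial: "vars (multi_partial V \<alpha> f) \<subseteq> vars f"
  by (simp add: multi_partial_def vars_partials)

text \<open>Only monomials have to be compared, and on them both sides are explicit and independent
  of the order of the operators. Indices outside \<open>D\<close> contribute derivatives of order
  0.\<close>

lemma partials_eq_multi_partial:
  assumes "distinct (map fst D)" "finite V" "fst ` set D \<subseteq> V"
    and \<alpha>: "\<And>i k. (i, k) \<in> set D \<Longrightarrow> \<alpha> i = k" "\<And>i. i \<notin> fst ` set D \<Longrightarrow> \<alpha> i = 0"
  shows "partials D f = multi_partial V \<alpha> f"
proof -
  have D: "D = map (\<lambda>i. (i, \<alpha> i)) (map fst D)"
    unfolding map_map by (rule map_idI[symmetric]) (use \<alpha>(1) in force)
  have "partials D (Poly_Mapping.single m c) = multi_partial V \<alpha> (Poly_Mapping.single m c)" for m c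
  proof -
    have "(\<Sum>i\<in>set (map fst D). Poly_Mapping.single i (\<alpha> i)) = (\<Sum>i\<in>V. Poly_Mapping.single i (\<alpha> i))"
      by (rule sum.mono_neutral_left) (use assms in auto)
    moreover have "(\<Prod>i\<in>set (map fst D). of_nat (fact (\<alpha> i) * (Poly_Mapping.lookup m i choose \<alpha> i)))
       = (\<Prod>i\<in>V. of_nat (fact (\<alpha> i) * (Poly_Mapping.lookup m i choose \<alpha> i)) :: complex)"
      by (rule prod.mono_neutral_left) (use assms in auto)
    ultimately show ?thesis
      by (subst D) (simp only: partials_single[OF assms(1)] multi_partial_single[OF assms(2)])
  qed
  then have "partials D (\<Sum>m\<in>Poly_Mapping.keys f. Poly_Mapping.single m (Poly_Mapping.lookup f m))
     = multi_partial V \<alpha> (\<Sum>m\<in>Poly_Mapping.keys f. Poly_Mapping.single m (Poly_Mapping.lookup f m))"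
    by (simp add: partials_sum multi_partial_sum)
  then show ?thesis by (simp add: sum_singles)
qed

text \<open>The additional terms have binomial coefficient 0. A bound common to all variables lets a
  product of such sums be multiplied out over one \<open>PiE\<close>.\<close>

lemma binomial_upto:
  assumes "n \<le> N"
  shows "((y :: 'a::comm_ring_1) + h) ^ n = (\<Sum>a\<le>N. of_nat (n choose a) * y ^ (n - a) * h ^ a)"
proof -
  have "(y + h) ^ n = (\<Sum>a\<le>n. of_nat (n choose a) * y ^ (n - a) * h ^ a)"
    unfolding add.commute[of y h] binomial_ring by (simp add: mult_ac)
  also have "\<dots> = (\<Sum>a\<le>N. of_nat (n choose a) * y ^ (n - a) * h ^ a)"
    by (rule sum.mono_neutral_left) (use assms in \<open>simp_all add: binomial_eq_0\<close>)
  finally show ?thesis .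
qed

lemma act_single:
  assumes "finite V" "Poly_Mapping.keys m \<subseteq> V"
  shows "act s (Poly_Mapping.single m c) = const c * (\<Prod>i\<in>V. var (s i) ^ Poly_Mapping.lookup m i)"
  unfolding act_def
  by (simp add: subst_single ring_hom_funD[OF ring_hom_fun_const] monom_val_superset[OF assms])

definition alpha_fact :: "nat set \<Rightarrow> (nat \<Rightarrow> nat) \<Rightarrow> complex" where
  "alpha_fact V \<alpha> = (\<Prod>i\<in>V. fact (\<alpha> i))"

lemma alpha_fact_nonzero: "alpha_fact V \<alpha> \<noteq> 0"
  by (cases "finite V") (auto simp: alpha_fact_def)

lemma const_of_nat: "const (of_nat n) = of_nat n"
  by (simp add: const_def)

lemma taylor_single:
  assumes V: "finite V" "Poly_Mapping.keys m \<subseteq> V" and N: "\<And>i. i \<in> V \<Longrightarrow> Poly_Mapping.lookup m i \<le> N"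
  shows "act s' (Poly_Mapping.single m c) = (\<Sum>\<alpha>\<in>PiE V (\<lambda>_. {..N}).
     const (inverse (alpha_fact V \<alpha>)) * act s (multi_partial V \<alpha> (Poly_Mapping.single m c))
       * (\<Prod>i\<in>V. (var (s' i) - var (s i)) ^ \<alpha> i))"
proof -
  let ?l = "Poly_Mapping.lookup m"
  have "act s (multi_partial V \<alpha> (Poly_Mapping.single m c))
      = const ((\<Prod>i\<in>V. of_nat (fact (\<alpha> i) * (?l i choose \<alpha> i))) * c) * (\<Prod>i\<in>V. var (s i) ^ (?l i - \<alpha> i))"
    for \<alpha>
  proof -
    let ?m = "m - (\<Sum>i\<in>V. Poly_Mapping.single i (\<alpha> i))"
    have l: "Poly_Mapping.lookup ?m i = ?l i - (if i \<in> V then \<alpha> i else 0)" for i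
      using V(1) by (simp add: lookup_minus lookup_sum lookup_single when_def)
    then have "Poly_Mapping.keys ?m \<subseteq> V" using V(2) by (auto simp: in_keys_iff)
    from act_single[OF V(1) this] show ?thesis
      unfolding multi_partial_single[OF V(1)] by (simp add: l cong: prod.cong)
  qed
  moreover have "const (inverse (alpha_fact V \<alpha>)) * const ((\<Prod>i\<in>V. of_nat (fact (\<alpha> i) * (?l i choose \<alpha> i))) * c)
      = const c * (\<Prod>i\<in>V. of_nat (?l i choose \<alpha> i))" for \<alpha>
  proof -
    have "inverse (alpha_fact V \<alpha>) * (alpha_fact V \<alpha> * (\<Prod>i\<in>V. of_nat (?l i choose \<alpha> i)) * c)
        = c * (\<Prod>i\<in>V. of_nat (?l i choose \<alpha> i))"
      using alpha_fact_nonzero[of V \<alpha>] by (simp add: field_simps)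
    moreover have "(\<Prod>i\<in>V. of_nat (fact (\<alpha> i) * (?l i choose \<alpha> i)))
        = alpha_fact V \<alpha> * (\<Prod>i\<in>V. of_nat (?l i choose \<alpha> i))"
      by (simp add: alpha_fact_def prod.distrib)
    ultimately have "inverse (alpha_fact V \<alpha>) * ((\<Prod>i\<in>V. of_nat (fact (\<alpha> i) * (?l i choose \<alpha> i))) * c)
        = c * (\<Prod>i\<in>V. of_nat (?l i choose \<alpha> i))" by simp
    from arg_cong[OF this, of const] show ?thesis
      by (simp only: const_simps ring_hom_fun_prod[OF ring_hom_fun_const] const_of_nat)
  qed
  ultimately have "(\<Sum>\<alpha>\<in>PiE V (\<lambda>_. {..N}).
     const (inverse (alpha_fact V \<alpha>)) * act s (multi_partial V \<alpha> (Poly_Mapping.single m c))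
       * (\<Prod>i\<in>V. (var (s' i) - var (s i)) ^ \<alpha> i))
    = (\<Sum>\<alpha>\<in>PiE V (\<lambda>_. {..N}). const c * (\<Prod>i\<in>V. of_nat (?l i choose \<alpha> i)
       * var (s i) ^ (?l i - \<alpha> i) * (var (s' i) - var (s i)) ^ \<alpha> i))"
    by (simp only: mult.assoc[symmetric] prod.distrib)
  also have "\<dots> = const c * (\<Prod>i\<in>V. \<Sum>a\<le>N. of_nat (?l i choose a)
       * var (s i) ^ (?l i - a) * (var (s' i) - var (s i)) ^ a)"
    unfolding sum_distrib_left[symmetric] by (subst prod_sum_PiE) (use V in auto)
  also have "\<dots> = const c * (\<Prod>i\<in>V. (var (s i) + (var (s' i) - var (s i))) ^ ?l i)"
    by (intro arg_cong2[where f="(*)"] prod.cong refl binomial_upto[symmetric] N)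
  also have "\<dots> = act s' (Poly_Mapping.single m c)"
    by (simp add: act_single[OF V])
  finally show ?thesis by simp
qed

text \<open>The expansion at the coordinates \<open>var (s i)\<close> in the increments
  \<open>var (s' i) - var (s i)\<close>, obtained for monomials by multiplying binomial expansions.
  Both maps are arbitrary, so several variables can be expanded at the same center, and one bound
  serves all pairs.\<close>

lemma taylor:
  assumes V: "finite V" "vars f \<subseteq> V"
  obtains N0 where "\<And>N s s'. N0 \<le> N \<Longrightarrow> act s' f = (\<Sum>\<alpha>\<in>PiE V (\<lambda>_. {..N}).
     const (inverse (alpha_fact V \<alpha>)) * act s (multi_partial V \<alpha> f) * (\<Prod>i\<in>V. (var (s' i) - var (s i)) ^ \<alpha> i))"
proof -
  let ?K = "Poly_Mapping.keys f"
  define N0 where "N0 = (\<Sum>m\<in>?K. \<Sum>i\<in>V. Poly_Mapping.lookup m i)"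
  have N: "Poly_Mapping.lookup m i \<le> N" if "m \<in> ?K" "i \<in> V" "N0 \<le> N" for m i N
  proof (rule order_trans[OF _ that(3)])
    show "Poly_Mapping.lookup m i \<le> N0"
      unfolding N0_def
      using member_le_sum[of i V "Poly_Mapping.lookup m"] V(1) that
        member_le_sum[of m ?K "\<lambda>m. \<Sum>i\<in>V. Poly_Mapping.lookup m i"] by fastforce
  qed
  have K: "m \<in> ?K \<Longrightarrow> Poly_Mapping.keys m \<subseteq> V" for m
    using V(2) by (auto simp: vars_def)
  let ?f = "\<lambda>m. Poly_Mapping.single m (Poly_Mapping.lookup f m)"
  have "act s' (\<Sum>m\<in>?K. ?f m) = (\<Sum>\<alpha>\<in>PiE V (\<lambda>_. {..N}).
     const (inverse (alpha_fact V \<alpha>)) * act s (multi_partial V \<alpha> (\<Sum>m\<in>?K. ?f m)) * (\<Prod>i\<in>V. (var (s' i) - var (s i)) ^ \<alpha> i))"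
    if "N0 \<le> N" for N s s'
  proof -
    have "act s' (\<Sum>m\<in>?K. ?f m) = (\<Sum>m\<in>?K. \<Sum>\<alpha>\<in>PiE V (\<lambda>_. {..N}).
     const (inverse (alpha_fact V \<alpha>)) * act s (multi_partial V \<alpha> (?f m)) * (\<Prod>i\<in>V. (var (s' i) - var (s i)) ^ \<alpha> i))"
      unfolding act_simps by (intro sum.cong refl taylor_single V(1) N K that)
    also have "\<dots> = (\<Sum>\<alpha>\<in>PiE V (\<lambda>_. {..N}). \<Sum>m\<in>?K.
     const (inverse (alpha_fact V \<alpha>)) * act s (multi_partial V \<alpha> (?f m)) * (\<Prod>i\<in>V. (var (s' i) - var (s i)) ^ \<alpha> i))"
      by (rule sum.swap)
    finally show ?thesis
      by (simp only: multi_partial_sum act_simps(8) sum_distrib_left sum_distrib_right)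
  qed
  then show ?thesis by (intro that[of N0]) (simp only: sum_singles)
qed

section \<open>Stable ideals and discriminants\<close>

text \<open>The sets \<open>s\<close> V - V\<open>and\<close>V - s \<open>V\<close> have the same
  size, so the first can be sent back to the second. Hence stable ideals admit every renaming that
  is injective on the variables involved.\<close>

lemma extend_to_permutation:
  assumes "finite V" "inj_on s (V :: nat set)"
  obtains \<tau> where "permutation \<tau>" "\<And>i. i \<in> V \<Longrightarrow> \<tau> i = s i"
proof -
  have "card (s ` V) = card V" using assms by (simp add: card_image)
  then have "card (s ` V - V) = card (V - s ` V)"
    using assms(1) by (simp add: card_Diff_subset_Int Int_commute)
  then obtain g where g: "bij_betw g (s ` V - V) (V - s ` V)"
    using assms(1) by (metis finite_Diff finite_imageI finite_same_card_bij)
  define \<tau> where "\<tau> i = (if i \<in> V then s i else if i \<in> s ` V then g i else i)" for i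
  have "bij_betw \<tau> V (s ` V)"
  proof (rule iffD2[OF bij_betw_cong inj_on_imp_bij_betw[OF assms(2)]])
    show "\<tau> i = s i" if "i \<in> V" for i using that by (simp add: \<tau>_def)
  qed
  moreover have "bij_betw \<tau> (s ` V - V) (V - s ` V)"
  proof (rule iffD2[OF bij_betw_cong g])
    show "\<tau> i = g i" if "i \<in> s ` V - V" for i using that by (simp add: \<tau>_def)
  qed
  ultimately have "bij_betw \<tau> (V \<union> (s ` V - V)) (s ` V \<union> (V - s ` V))"
    by (rule bij_betw_combine) auto
  then have "bij_betw \<tau> (V \<union> s ` V) (V \<union> s ` V)" by (simp only: Un_Diff_cancel Un_commute[of "s ` V" V])
  then have "\<tau> permutes (V \<union> s ` V)" by (rule bij_imp_permutes) (auto simp: \<tau>_def)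
  then have "permutation \<tau>"
    unfolding permutation_permutes using assms(1) by (meson finite_UnI finite_imageI)
  then show ?thesis by (rule that) (simp add: \<tau>_def)
qed

text \<open>The stabiliser of the indices reserved for the centers; \<open>perms 0\<close> is the
  full group.\<close>

definition perms :: "nat \<Rightarrow> (nat \<Rightarrow> nat) set" where
  "perms r = {\<sigma>. permutation \<sigma> \<and> (\<forall>j<r. \<sigma> j = j)}"

lemma perms_inj: "\<sigma> \<in> perms r \<Longrightarrow> inj \<sigma>"
  by (auto simp: perms_def permutation_bijective bij_is_inj)

lemma perms_comp: "\<sigma> \<in> perms r \<Longrightarrow> \<tau> \<in> perms r \<Longrightarrow> (\<lambda>i. \<sigma> (\<tau> i)) \<in> perms r"
  using permutation_compose[of \<sigma> \<tau>] by (auto simp: perms_def comp_def)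

lemma perms_inv:
  assumes "\<sigma> \<in> perms r"
  shows "inv \<sigma> \<in> perms r"
  using assms perms_inj[OF assms] by (auto simp: perms_def permutation_inverse inv_f_eq)

lemma perms_id: "(\<lambda>i. i) \<in> perms r"
  using permutation_id by (simp add: perms_def id_def)

lemma perms_ge: "\<sigma> \<in> perms r \<Longrightarrow> r \<le> i \<Longrightarrow> r \<le> \<sigma> i"
  using perms_inj[of \<sigma> r] by (auto simp: perms_def inj_def) (metis leI leD)

text \<open>Carries a permutation of the original variables over to their shifted copies, so that
  primality of \<open>P\<close> can be used for ideals with centers.\<close>

lemma perms_shift:
  assumes "permutation \<sigma>"
  shows "(\<lambda>j. if j < r then j else \<sigma> (j - r) + r) \<in> perms r" (is "?s \<in> _")
proof -
  have inj: "inj \<sigma>" using assms by (simp add: permutation_bijective bij_is_inj)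
  have "finite ((\<lambda>i. i + r) ` {i. \<sigma> i \<noteq> i})" (is "finite ?B")
    using assms by (intro finite_imageI) (simp add: permutation_finite_support)
  moreover have "{x. ?s x \<noteq> x} \<subseteq> ?B"
  proof
    fix x assume "x \<in> {x. ?s x \<noteq> x}"
    then show "x \<in> ?B" by (intro image_eqI[of _ _ "x - r"]) (auto split: if_splits)
  qed
  ultimately have fin: "finite {x. ?s x \<noteq> x}" by (rule finite_subset[rotated])
  have "bij ?s"
  proof (rule bijI)
    show "inj ?s"
    proof (rule injI)
      fix x y assume xy: "?s x = ?s y"
      then have "x < r \<longleftrightarrow> y < r" by (auto split: if_splits)
      then show "x = y" using xy injD[OF inj, of "x - r" "y - r"] by (auto split: if_splits)
    qed
    show "surj ?s"
    proof (rule surjI[of _ "\<lambda>j. if j < r then j else inv \<sigma> (j - r) + r"])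
      show "?s ((if x < r then x else inv \<sigma> (x - r) + r)) = x" for x
        using assms by (auto simp: permutation_inverse_works surj_f_inv_f bij_is_surj permutation_bijective)
    qed
  qed
  then show ?thesis using fin by (simp add: perms_def permutation)
qed

definition stable_ideal :: "nat \<Rightarrow> R set \<Rightarrow> bool" where
  "stable_ideal r Q \<longleftrightarrow> ideal.subspace Q \<and> (\<forall>\<sigma>\<in>perms r. \<forall>f\<in>Q. act \<sigma> f \<in> Q)"

text \<open>Equivariant primality on elements: the analogue of the condition
  \<open>a R b \<subseteq> P\<close> for prime ideals of noncommutative rings.\<close>

definition orbit_prime :: "nat \<Rightarrow> R set \<Rightarrow> bool" where
  "orbit_prime r Q \<longleftrightarrow> (\<forall>f g. (\<forall>\<sigma>\<in>perms r. f * act \<sigma> g \<in> Q) \<longrightarrow> f \<in> Q \<or> g \<in> Q)"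

definition orbit :: "nat \<Rightarrow> R \<Rightarrow> R set" where
  "orbit r f = (\<lambda>\<sigma>. act \<sigma> f) ` perms r"

lemma orbit_self: "f \<in> orbit r f"
  unfolding orbit_def by (rule image_eqI[OF _ perms_id]) (simp add: act_ident)

lemma orbit_act: "\<sigma> \<in> perms r \<Longrightarrow> g \<in> orbit r f \<Longrightarrow> act \<sigma> g \<in> orbit r f"
  unfolding orbit_def by (auto simp: act_act perms_comp)

lemma stable_ideal_iff_S_ideal: "stable_ideal 0 P \<longleftrightarrow> S_ideal P"
  by (simp add: stable_ideal_def S_ideal_def perms_def)

lemma span_mult_mem:
  assumes I: "ideal.subspace I" and ST: "\<And>a b. a \<in> S \<Longrightarrow> b \<in> T \<Longrightarrow> a * b \<in> I"
    and "x \<in> ideal.span S" "y \<in> ideal.span T"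
  shows "x * y \<in> I"
proof -
  have 1: "a * y \<in> I" if "a \<in> S" for a
  proof -
    have "ideal.span T \<subseteq> {y. a * y \<in> I}"
    proof (rule ideal.span_minimal)
      show "ideal.subspace {y. a * y \<in> I}"
        by (rule ideal.subspaceI)
          (use I in \<open>auto simp: ideal.subspace_0 ideal.subspace_add ideal.subspace_scale distrib_left mult.left_commute\<close>)
    qed (use ST that in auto)
    then show ?thesis using assms(4) by blast
  qed
  have "ideal.span S \<subseteq> {x. x * y \<in> I}"
  proof (rule ideal.span_minimal)
    show "ideal.subspace {x. x * y \<in> I}"
      by (rule ideal.subspaceI)
        (use I in \<open>auto simp: ideal.subspace_0 ideal.subspace_add ideal.subspace_scale distrib_right mult.assoc\<close>)
  qed (use 1 in auto)
  then show ?thesis using assms(3) by blast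
qed

lemma stable_ideal_span:
  assumes "\<And>\<sigma> f. \<sigma> \<in> perms r \<Longrightarrow> f \<in> S \<Longrightarrow> act \<sigma> f \<in> S"
  shows "stable_ideal r (ideal.span S)"
proof -
  have "act \<sigma> f \<in> ideal.span S" if "\<sigma> \<in> perms r" "f \<in> ideal.span S" for \<sigma> f
  proof -
    have "ideal.span S \<subseteq> {f. act \<sigma> f \<in> ideal.span S}"
    proof (rule ideal.span_minimal)
      show "ideal.subspace {f. act \<sigma> f \<in> ideal.span S}"
        by (rule ideal.subspaceI) (auto simp: ideal.span_zero ideal.span_add ideal.span_scale)
    qed (use assms that ideal.span_base in auto)
    then show ?thesis using that by blast
  qed
  then show ?thesis by (simp add: stable_ideal_def)
qed

text \<open>Primality is applied to the ideals generated by the two orbits. A product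
  \<open>\<sigma> f * \<tau> g\<close> is the \<open>\<sigma>\<close>-translate of the product of
  \<open>f\<close> with a translate of \<open>g\<close>.\<close>

lemma S_prime_orbit_prime:
  assumes "S_prime P"
  shows "orbit_prime 0 P"
  unfolding orbit_prime_def
proof (intro allI impI)
  fix f g assume fg: "\<forall>\<sigma>\<in>perms 0. f * act \<sigma> g \<in> P"
  have P: "ideal.subspace P" and st: "stable_ideal 0 P"
    using assms by (auto simp: S_prime_def S_ideal_def stable_ideal_iff_S_ideal)
  have S: "S_ideal (ideal.span (orbit 0 h))" for h
    unfolding stable_ideal_iff_S_ideal[symmetric] by (rule stable_ideal_span) (rule orbit_act)
  have prod: "a * b \<in> P" if ab: "a \<in> orbit 0 f" "b \<in> orbit 0 g" for a b
  proof -
    obtain \<sigma> \<tau> where st': "\<sigma> \<in> perms 0" "\<tau> \<in> perms 0" "a = act \<sigma> f" "b = act \<tau> g"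
      using ab by (auto simp: orbit_def)
    have "f * act (\<lambda>i. inv \<sigma> (\<tau> i)) g \<in> P"
      using fg perms_comp[OF perms_inv[OF st'(1)] st'(2)] by blast
    then have "act \<sigma> (f * act (\<lambda>i. inv \<sigma> (\<tau> i)) g) \<in> P"
      using st st'(1) unfolding stable_ideal_def by blast
    also have "act \<sigma> (f * act (\<lambda>i. inv \<sigma> (\<tau> i)) g) = a * b"
      using st' by (simp add: act_act permutation_bijective bij_is_surj surj_f_inv_f perms_def)
    finally show ?thesis .
  qed
  have "ideal_prod (ideal.span (orbit 0 f)) (ideal.span (orbit 0 g)) \<subseteq> P"
    unfolding ideal_prod_def
    by (rule ideal.span_minimal[OF _ P]) (auto intro!: span_mult_mem[OF P prod])
  then have "ideal.span (orbit 0 f) \<subseteq> P \<or> ideal.span (orbit 0 g) \<subseteq> P"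
    using assms S unfolding S_prime_def by blast
  then show "f \<in> P \<or> g \<in> P"
    using ideal.span_base[OF orbit_self] by blast
qed

lemma S_ideal_act_inj:
  assumes "S_ideal P" "f \<in> P" "inj_on s (vars f)"
  shows "act s f \<in> P"
proof -
  obtain \<tau> where "permutation \<tau>" "\<And>i. i \<in> vars f \<Longrightarrow> \<tau> i = s i"
    using extend_to_permutation[OF finite_vars assms(3)] by blast
  then have "act \<tau> f \<in> P" "act \<tau> f = act s f"
    using assms by (auto simp: S_ideal_def intro: act_cong)
  then show ?thesis by simp
qed

section \<open>Discriminants and Vandermonde elimination\<close>

definition disc :: "nat set \<Rightarrow> R" where
  "disc A = (\<Prod>(a, b)\<in>{(a, b). a \<in> A \<and> b \<in> A \<and> a \<noteq> b}. var a - var b)"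

lemma finite_disc_index: "finite A \<Longrightarrow> finite {(a, b). a \<in> A \<and> b \<in> A \<and> a \<noteq> b}"
  by (rule finite_subset[of _ "A \<times> A"]) auto

text \<open>Taking ordered pairs makes \<open>disc\<close> the square of a Vandermonde product up to
  sign, so renaming introduces no sign.\<close>

lemma act_disc:
  assumes "inj_on s A"
  shows "act s (disc A) = disc (s ` A)"
proof -
  let ?X = "\<lambda>A. {(a, b). a \<in> A \<and> b \<in> A \<and> a \<noteq> b} :: (nat \<times> nat) set"
  have "bij_betw (map_prod s s) (?X A) (?X (s ` A))"
    using assms by (fastforce simp: bij_betw_def inj_on_def)
  then show ?thesis
    unfolding disc_def act_simps
    by (subst prod.reindex_bij_betw[symmetric]) (auto intro!: prod.cong)
qed

lemma disc_dvd: "finite B \<Longrightarrow> A \<subseteq> B \<Longrightarrow> disc A dvd disc B"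
  unfolding disc_def by (rule prod_dvd_prod_subset[OF finite_disc_index]) auto

lemma diff_dvd_disc: "finite A \<Longrightarrow> a \<in> A \<Longrightarrow> b \<in> A \<Longrightarrow> a \<noteq> b \<Longrightarrow> var a - var b dvd disc A"
  unfolding disc_def using dvd_prodI[OF finite_disc_index, of A "(a, b)" "\<lambda>(a, b). var a - var b"] by auto

lemma disc_insert:
  assumes "finite A" "y \<notin> A"
  shows "disc (insert y A) = disc A * ((\<Prod>a\<in>A. var y - var a) * (\<Prod>a\<in>A. var a - var y))"
proof -
  let ?X = "\<lambda>A. {(a, b). a \<in> A \<and> b \<in> A \<and> a \<noteq> b} :: (nat \<times> nat) set"
  let ?f = "\<lambda>(a, b). var a - var b"
  have "?X (insert y A) = ?X A \<union> (Pair y ` A \<union> (\<lambda>a. (a, y)) ` A)"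
    using assms by auto
  then have "disc (insert y A) = prod ?f (?X A \<union> (Pair y ` A \<union> (\<lambda>a. (a, y)) ` A))"
    unfolding disc_def by simp
  also have "\<dots> = prod ?f (?X A) * (prod ?f (Pair y ` A) * prod ?f ((\<lambda>a. (a, y)) ` A))"
    using assms finite_disc_index[OF assms(1)]
    by (subst prod.union_disjoint; (subst prod.union_disjoint)?) auto
  also have "prod ?f (Pair y ` A) = (\<Prod>a\<in>A. var y - var a)"
    by (subst prod.reindex) (auto simp: inj_on_def)
  also have "prod ?f ((\<lambda>a. (a, y)) ` A) = (\<Prod>a\<in>A. var a - var y)"
    by (subst prod.reindex) (auto simp: inj_on_def)
  finally show ?thesis by (simp add: disc_def)
qed

lemma vars_disc: "vars (disc A) \<subseteq> A"
  unfolding disc_def using vars_minus by (intro order_trans[OF vars_prod] UN_least) fastforce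

lemma disc_trivial: "card A \<le> 1 \<Longrightarrow> finite A \<Longrightarrow> disc A = 1"
  by (auto simp: disc_def le_Suc_eq card_1_singleton_iff intro: prod.neutral)

lemma lead_coeff_synthetic_div:
  fixes p :: "'a::comm_ring_1 poly"
  assumes "degree p = Suc d"
  shows "degree (synthetic_div p c) = d" "lead_coeff (synthetic_div p c) = lead_coeff p"
proof -
  let ?q = "synthetic_div p c"
  show d: "degree ?q = d" using assms by (simp add: degree_synthetic_div)
  have "p = [:-c, 1:] * ?q + [:poly p c:]" by (rule synthetic_div_correct'[symmetric])
  then have "coeff p (Suc d) = coeff ([:-c, 1:] * ?q + [:poly p c:]) (Suc d)" by simp
  also have "\<dots> = coeff ?q d"
    using d by (simp add: coeff_eq_0)
  finally show "lead_coeff ?q = lead_coeff p" using assms d by simp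
qed

text \<open>Divided differences: \<open>p(y) - p(y0) = (y - y0) q(y)\<close>, where \<open>q\<close>
  has smaller degree and the same leading coefficient. The factors \<open>y - y0\<close> are
  absorbed by the discriminant.\<close>

lemma vandermonde_elimination:
  assumes I: "ideal.subspace I"
  shows "finite Y \<Longrightarrow> card Y = Suc (degree p) \<Longrightarrow> (\<And>y. y \<in> Y \<Longrightarrow> h * poly p (var y) \<in> I)
    \<Longrightarrow> h * disc Y * lead_coeff p \<in> I"
proof (induction "degree p" arbitrary: p Y h)
  case 0
  then obtain y where Y: "Y = {y}" by (metis card_1_singletonE One_nat_def)
  obtain a where "p = [:a:]" using 0 by (metis degree_eq_zeroE)
  then show ?case using 0(4)[of y] Y by (simp add: disc_trivial)
next
  case (Suc d)
  then obtain y0 Y' where Y: "Y = insert y0 Y'" "y0 \<notin> Y'" "finite Y'" "card Y' = Suc d"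
    by (metis card_Suc_eq_finite)
  let ?q = "synthetic_div p (var y0)"
  have q: "degree ?q = d" "lead_coeff ?q = lead_coeff p"
    using lead_coeff_synthetic_div[of p d] Suc(2) by auto
  let ?h = "h * (\<Prod>y\<in>Y'. var y - var y0)"
  have "?h * disc Y' * lead_coeff ?q \<in> I"
  proof (rule Suc(1))
    fix y assume y: "y \<in> Y'"
    have "poly p (var y) = (var y - var y0) * poly ?q (var y) + poly p (var y0)"
      by (subst synthetic_div_correct'[of "var y0" p, symmetric]) (simp add: left_diff_distrib)
    then have "h * ((var y - var y0) * poly ?q (var y)) = h * poly p (var y) - h * poly p (var y0)"
      by (simp add: distrib_left)
    also have "\<dots> \<in> I" by (rule ideal.subspace_diff[OF I]) (use Suc Y y in auto)
    finally have "h * ((var y - var y0) * poly ?q (var y)) \<in> I" .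
    then show "?h * poly ?q (var y) \<in> I"
      by (rule ideal_dvd[OF I]) (use Y y in \<open>simp add: prod.remove[of Y' y] mult_ac mult_dvd_mono\<close>)
  qed (use q Y in auto)
  then show ?case
    by (rule ideal_dvd[OF I]) (use Y q in \<open>simp add: disc_insert mult_ac mult_dvd_mono\<close>)
qed

definition to_poly :: "nat \<Rightarrow> R \<Rightarrow> R poly" where
  "to_poly i f = subst (\<lambda>c. [:const c:]) (\<lambda>j. if j = i then [:0, 1:] else [:var j:]) f"

text \<open>Evaluation at a fresh variable is a renaming, so one element of a stable ideal yields
  the values of one polynomial at as many variables as elimination requires.\<close>

lemma poly_to_poly: "poly (to_poly i f) (var y) = act (\<lambda>j. if j = i then y else j) f"
proof -
  have "ring_hom_fun (\<lambda>p. poly p (var y))" by (simp add: ring_hom_fun_def)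
  from hom_subst[OF this] show ?thesis
    unfolding to_poly_def act_def by (auto intro!: arg_cong2[where f="\<lambda>h x. subst h x f"])
qed

lemma vars_coeff_to_poly: "vars (coeff (to_poly i f) n) \<subseteq> vars f - {i}"
proof -
  define good where "good p \<longleftrightarrow> (\<forall>n. vars (coeff p n) \<subseteq> vars f - {i})" for p :: "R poly"
  have z: "vars 0 = {}" by (simp add: vars_def)
  have const: "good [:const c:]" for c by (auto simp: good_def z coeff_pCons split: nat.splits)
  have one: "good 1" using const[of 1] by (simp add: const_simps one_pCons)
  have var: "good (if j = i then [:0, 1:] else [:var j:])" if "j \<in> vars f" for j
    using that by (auto simp: good_def z coeff_pCons split: nat.splits)
  have mult: "good (p * q)" if "good p" "good q" for p q
    unfolding good_def coeff_mult
  proof (intro allI order_trans[OF vars_sum] UN_least order_trans[OF vars_mult])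
    fix n k show "vars (coeff p k) \<union> vars (coeff q (n - k)) \<subseteq> vars f - {i}"
      using that unfolding good_def by blast
  qed
  have pw: "good p \<Longrightarrow> good (p ^ n)" for p n by (induction n) (auto simp: one mult)
  have pr: "(\<And>i. i \<in> A \<Longrightarrow> good (g i)) \<Longrightarrow> good (prod g A)" for g and A :: "nat set"
    by (induction A rule: infinite_finite_induct) (auto simp: one mult)
  have add: "good (p + q)" if "good p" "good q" for p q
    unfolding good_def coeff_add
  proof (intro allI order_trans[OF vars_add])
    fix n show "vars (coeff p n) \<union> vars (coeff q n) \<subseteq> vars f - {i}"
      using that unfolding good_def by blast
  qed
  have sm: "(\<And>i. i \<in> A \<Longrightarrow> good (g i)) \<Longrightarrow> good (sum g A)" for g and A :: "monom set"
    by (induction A rule: infinite_finite_induct) (use const[of 0] in \<open>auto simp: add const_simps\<close>)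
  have "good (to_poly i f)"
    unfolding to_poly_def subst_def
    by (intro sm mult const pr pw var) (auto simp: vars_def)
  then show ?thesis by (simp add: good_def)
qed

lemma vars_empty_const:
  assumes "vars f = {}"
  shows "f = const (Poly_Mapping.lookup f 0)"
proof -
  have "Poly_Mapping.keys f \<subseteq> {0}" using assms by (auto simp: vars_def)
  then show ?thesis
    by (intro poly_mapping_eqI) (auto simp: const_def lookup_single when_def in_keys_iff)
qed

text \<open>Each round renames one variable of \<open>f\<close> to more fresh variables than the
  degree and passes to the leading coefficient, at the cost of a larger discriminant. Keeping
  \<open>A\<close> disjoint from \<open>vars f\<close> ensures that the renaming fixes
  \<open>disc A\<close>. In the end a non-zero constant is left.\<close>

lemma disc_power_mem:
  assumes P: "S_ideal P" and "f \<noteq> 0" "finite A" "A \<inter> vars f = {}" "disc A ^ K * f \<in> P"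
  shows "\<exists>B K. finite B \<and> disc B ^ K \<in> P"
  using assms(2-)
proof (induction "card (vars f)" arbitrary: f A K rule: less_induct)
  case less
  have I: "ideal.subspace P" using P by (simp add: S_ideal_def)
  show ?case
  proof (cases "vars f = {}")
    case True
    then obtain c where c: "f = const c" using vars_empty_const by blast
    then have "c \<noteq> 0" using less by (auto simp: const_simps)
    have "disc A ^ K * f * const (inverse c) = disc A ^ K * (const (inverse c) * const c)"
      using c by (simp add: algebra_simps)
    also have "\<dots> = disc A ^ K" using const_inverse[OF \<open>c \<noteq> 0\<close>] by simp
    finally have "disc A ^ K \<in> P"
      using ideal_mult(1)[OF I less.prems(4), of "const (inverse c)"] by (simp only:)
    then show ?thesis using less.prems(2) by blast
  next
    case False
    then obtain i where i: "i \<in> vars f" by blast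
    let ?p = "to_poly i f"
    have "?p \<noteq> 0"
    proof
      assume "?p = 0"
      then have "act (\<lambda>j. if j = i then i else j) f = 0" unfolding poly_to_poly[symmetric] by simp
      moreover have "act (\<lambda>j. if j = i then i else j) f = f" by (rule act_ident) auto
      ultimately show False using less.prems by simp
    qed
    have "infinite (UNIV - (A \<union> vars f))" using less.prems finite_vars by simp
    then obtain Y where Y: "finite Y" "card Y = Suc (degree ?p)" "Y \<subseteq> UNIV - (A \<union> vars f)"
      using infinite_arbitrarily_large by blast
    have "disc A ^ K * poly ?p (var y) \<in> P" if y: "y \<in> Y" for y
    proof -
      let ?s = "\<lambda>j. if j = i then y else j"
      have "vars (disc A ^ K * f) \<subseteq> A \<union> vars f"
        using vars_mult[of "disc A ^ K" f] vars_power[of "disc A" K] vars_disc[of A] by blast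
      then have "inj_on ?s (vars (disc A ^ K * f))" using Y y by (auto simp: inj_on_def)
      from S_ideal_act_inj[OF P less.prems(4) this] have "act ?s (disc A) ^ K * act ?s f \<in> P" by simp
      moreover have "act ?s (disc A) = disc A"
        by (rule act_ident) (use vars_disc[of A] i less.prems in auto)
      ultimately show ?thesis by (simp add: poly_to_poly)
    qed
    from vandermonde_elimination[OF I Y(1,2) this]
    have m: "disc A ^ K * disc Y * lead_coeff ?p \<in> P" .
    have "disc A ^ K dvd disc (A \<union> Y) ^ K" "disc Y dvd disc (A \<union> Y)"
      using Y less.prems by (auto intro!: dvd_power_same disc_dvd)
    then have "disc A ^ K * disc Y dvd disc (A \<union> Y) ^ Suc K"
      using mult_dvd_mono by (metis power_Suc2)
    then have m': "disc (A \<union> Y) ^ Suc K * lead_coeff ?p \<in> P"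
      using ideal_dvd[OF I m] by (simp add: mult_dvd_mono)
    have v: "vars (lead_coeff ?p) \<subseteq> vars f - {i}" by (rule vars_coeff_to_poly)
    show ?thesis
    proof (rule less.hyps[OF _ _ _ _ m'])
      show "card (vars (lead_coeff ?p)) < card (vars f)"
        using v i finite_vars[of f] by (metis card_Diff1_less card_mono finite_Diff le_less_trans)
      show "(A \<union> Y) \<inter> vars (lead_coeff ?p) = {}" using v Y less.prems by blast
    qed (use \<open>?p \<noteq> 0\<close> Y less.prems in auto)
  qed
qed

text \<open>\<open>r + 1\<close> is the least size of a set with a power of its discriminant in
  \<open>P\<close>. Sets of equal size are renamings of each other, so one exponent serves them
  all.\<close>

lemma S_prime_rank:
  assumes P: "S_prime P" "P \<noteq> {0}"
  obtains r k where "r \<ge> 1" "\<And>K. disc {..<r} ^ K \<notin> P"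
    "\<And>A. finite A \<Longrightarrow> card A = Suc r \<Longrightarrow> disc A ^ k \<in> P"
proof -
  have S: "S_ideal P" and I: "ideal.subspace P" and "P \<noteq> UNIV"
    using P by (auto simp: S_prime_def S_ideal_def)
  have one: "1 \<notin> P" using \<open>P \<noteq> UNIV\<close> ideal_mult(2)[OF I, of 1] by auto
  let ?Q = "\<lambda>n. \<exists>A K. finite A \<and> card A = n \<and> disc A ^ K \<in> P"
  obtain f where f: "f \<in> P" "f \<noteq> 0" using P(2) ideal.subspace_0[OF I] by blast
  then have "\<exists>B K. finite B \<and> disc B ^ K \<in> P"
    by (intro disc_power_mem[OF S, of f "{}" 0]) auto
  then have ex: "\<exists>n. ?Q n" by blast
  define n where "n = (LEAST n. ?Q n)"
  have "?Q n" unfolding n_def using ex by (rule LeastI_ex)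
  then obtain A k where A: "finite A" "card A = n" "disc A ^ k \<in> P" by blast
  \<comment> \<open>The discriminant of at most one variable is 1.\<close>
  have "n > 1" using one A disc_trivial[of A] by (cases "n > 1") auto
  show ?thesis
  proof (rule that[of "n - 1" k])
    show "disc {..<n - 1} ^ K \<notin> P" for K
    proof
      assume "disc {..<n - 1} ^ K \<in> P"
      then have "?Q (n - 1)" by (intro exI[of _ "{..<n - 1}"] exI[of _ K]) auto
      then have "n \<le> n - 1" by (rule Least_le[of ?Q "n - 1", folded n_def])
      then show False using \<open>n > 1\<close> by simp
    qed
    show "disc B ^ k \<in> P" if B: "finite B" "card B = Suc (n - 1)" for B
    proof -
      obtain s where s: "bij_betw s A B" using A B \<open>n > 1\<close> finite_same_card_bij[of A B] by auto
      have "vars (disc A ^ k) \<subseteq> A" using vars_power vars_disc by blast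
      then have "inj_on s (vars (disc A ^ k))" using s by (auto simp: bij_betw_def intro: inj_on_subset)
      from S_ideal_act_inj[OF S A(3) this] show ?thesis
        using s by (simp add: act_disc bij_betw_def)
    qed
  qed (use \<open>n > 1\<close> in auto)
qed

section \<open>Adjoining the centers\<close>

lemma orbit_mult_mem:
  assumes Q: "stable_ideal r Q" and FG: "\<And>\<sigma>. \<sigma> \<in> perms r \<Longrightarrow> F * act \<sigma> G \<in> Q"
    and x: "x \<in> ideal.span (Q \<union> orbit r F)" and y: "y \<in> ideal.span (Q \<union> orbit r G)"
  shows "x * y \<in> Q"
proof -
  have I: "ideal.subspace Q" using Q by (simp add: stable_ideal_def)
  have "a * b \<in> Q" if ab: "a \<in> orbit r F" "b \<in> orbit r G" for a b
  proof -
    obtain \<sigma> \<tau> where s: "\<sigma> \<in> perms r" "\<tau> \<in> perms r" "a = act \<sigma> F" "b = act \<tau> G"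
      using ab by (auto simp: orbit_def)
    have "F * act (\<lambda>i. inv \<sigma> (\<tau> i)) G \<in> Q"
      using FG perms_comp[OF perms_inv[OF s(1)] s(2)] by blast
    then have "act \<sigma> (F * act (\<lambda>i. inv \<sigma> (\<tau> i)) G) \<in> Q"
      using Q s(1) unfolding stable_ideal_def by blast
    also have "act \<sigma> (F * act (\<lambda>i. inv \<sigma> (\<tau> i)) G) = a * b"
      using s by (simp add: act_act permutation_bijective bij_is_surj surj_f_inv_f perms_def)
    finally show ?thesis .
  qed
  then have "a * b \<in> Q" if "a \<in> Q \<union> orbit r F" "b \<in> Q \<union> orbit r G" for a b
    using that ideal_mult[OF I] by blast
  from span_mult_mem[OF I this x y] show ?thesis .
qed

lemma S_prime_orbit_primeD:
  assumes "S_prime P" "\<And>\<sigma>. permutation \<sigma> \<Longrightarrow> f * act \<sigma> g \<in> P"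
  shows "f \<in> P \<or> g \<in> P"
  using S_prime_orbit_prime[OF assms(1)] assms(2) by (auto simp: orbit_prime_def perms_def)

text \<open>Adjoin \<open>r\<close> further variables, the centers, as the first \<open>r\<close> variables of \<open>R\<close>, and move
  the old variables up by \<open>r\<close>. The ideal \<open>I\<close> in the proof forces every old variable to be
  infinitely near to a center; enlarging it to a maximal ideal that still lies over \<open>P\<close> makes
  it prime for the group that fixes the centers.\<close>

lemma exists_centered_ideal:
  assumes P: "S_prime P" and nk: "\<And>K. disc {..<r} ^ K \<notin> P"
    and k: "\<And>A. finite A \<Longrightarrow> card A = Suc r \<Longrightarrow> disc A ^ k \<in> P"
  obtains Q where "stable_ideal r Q" "orbit_prime r Q" "disc {..<r} \<notin> Q"
    "\<And>f. act (\<lambda>i. i + r) f \<in> Q \<longleftrightarrow> f \<in> P"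
    "\<And>i. r \<le> i \<Longrightarrow> (\<Prod>j<r. (var i - var j) ^ (2 * k)) \<in> Q"
proof -
  have S: "S_ideal P" and PI: "ideal.subspace P"
    using P by (auto simp: S_prime_def S_ideal_def)
  let ?D = "disc {..<r}"
  let ?\<phi> = "act (\<lambda>i. i + r)"
  have actD: "act s ?D = ?D" if "\<And>j. j < r \<Longrightarrow> s j = j" for s
    by (rule act_ident) (use that vars_disc[of "{..<r}"] in auto)
  \<comment> \<open>These specialisations send \<open>t\<^sub>j\<close> to
    \<open>\<xi>\<^sub>j\<close> and the old variables injectively anywhere, possibly among the
    first \<open>r\<close>. The ideal \<open>I\<close> collects what all of them send into
    \<open>P\<close> after multiplication by \<open>?D ^ k\<close>.\<close>
  define adm where "adm s \<longleftrightarrow> (\<forall>j<r. s j = j) \<and> inj_on s {r..}" for s :: "nat \<Rightarrow> nat"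
  define I where "I = {F. \<forall>s. adm s \<longrightarrow> ?D ^ k * act s F \<in> P}"
  have I: "ideal.subspace I"
    by (rule ideal.subspaceI) (auto simp: I_def ideal.subspace_0[OF PI] distrib_left mult.left_commute
        intro: ideal.subspace_add[OF PI] ideal_mult[OF PI])
  have admp: "adm (\<lambda>i. s (\<sigma> i))" if "adm s" "\<sigma> \<in> perms r" for s \<sigma>
    unfolding adm_def
  proof (intro conjI inj_onI allI impI)
    fix x y assume "x \<in> {r..}" "y \<in> {r..}" "s (\<sigma> x) = s (\<sigma> y)"
    then have "\<sigma> x = \<sigma> y" using that perms_ge[OF that(2)] by (auto simp: adm_def inj_on_def)
    then show "x = y" using perms_inj[OF that(2)] by (auto simp: inj_def)
  qed (use that in \<open>auto simp: adm_def perms_def\<close>)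
  have Ist: "stable_ideal r I"
    unfolding stable_ideal_def
  proof (intro conjI I ballI)
    fix \<sigma> f assume "\<sigma> \<in> perms r" "f \<in> I"
    then show "act \<sigma> f \<in> I" using admp by (simp add: I_def act_act)
  qed
  have IP: "f \<in> P" if M: "?D ^ M * ?\<phi> f \<in> I" for f M
  proof -
    have "?D ^ (k + M) * act \<sigma> f \<in> P" if "permutation \<sigma>" for \<sigma>
    proof -
      \<comment> \<open>This specialisation undoes the shift and then applies
        \<open>\<sigma>\<close>, which turns \<open>?\<phi> f\<close> into the translate of
        \<open>f\<close>.\<close>
      let ?s = "\<lambda>i. if i < r then i else \<sigma> (i - r)"
      have "inj \<sigma>" using that by (simp add: permutation_bijective bij_is_inj)
      have "adm ?s"
        unfolding adm_def
      proof (intro conjI inj_onI)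
        fix x y assume "x \<in> {r..}" "y \<in> {r..}" "?s x = ?s y"
        then show "x = y" using injD[OF \<open>inj \<sigma>\<close>, of "x - r" "y - r"] by auto
      qed simp
      then have "?D ^ k * act ?s (?D ^ M * ?\<phi> f) \<in> P" using M by (simp add: I_def)
      then show ?thesis by (simp add: actD act_act power_add mult.assoc)
    qed
    then show ?thesis using S_prime_orbit_primeD[OF P] nk by blast
  qed
  have PhiI: "?\<phi> f \<in> I" if "f \<in> P" for f
    unfolding I_def mem_Collect_eq
  proof (intro allI impI)
    fix s assume "adm s"
    then have "act (\<lambda>i. s (i + r)) f \<in> P"
      by (intro S_ideal_act_inj[OF S that] inj_onI) (auto simp: adm_def dest: inj_onD)
    then show "?D ^ k * act s (?\<phi> f) \<in> P" by (simp add: act_act ideal_mult[OF PI])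
  qed
  \<comment> \<open>Exponent 0 would put 1 into \<open>P\<close>. Positivity makes the product below
    vanish when \<open>\<xi>\<^sub>i\<close> is specialised to a center.\<close>
  have "k > 0" using k[of "{..r}"] ideal_mult(1)[OF PI, of 1] nk[of 0] by (cases k) auto
  have NI: "(\<Prod>j<r. (var i - var j) ^ (2 * k)) \<in> I" if "r \<le> i" for i
    unfolding I_def mem_Collect_eq
  proof (intro allI impI)
    fix s assume s: "adm s"
    have a: "act s (\<Prod>j<r. (var i - var j) ^ (2 * k)) = (\<Prod>j<r. (var (s i) - var j) ^ (2 * k))"
      using s by (simp add: adm_def)
    show "?D ^ k * act s (\<Prod>j<r. (var i - var j) ^ (2 * k)) \<in> P"
    proof (cases "s i < r")
      case True
      then have 0: "(\<Prod>j<r. (var (s i) - var j) ^ (2 * k)) = 0"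
        using \<open>k > 0\<close> by (intro prod_zero) (auto intro!: bexI[of _ "s i"])
      show ?thesis unfolding a 0 using ideal.subspace_0[OF PI] by simp
    next
      case False
      let ?y = "var (s i)"
      \<comment> \<open>Up to sign this discriminant is \<open>?D\<close> times the square of the
        product of the differences to the centers; hence the exponent \<open>2 * k\<close>.\<close>
      have m: "disc (insert (s i) {..<r}) ^ k \<in> P" by (rule k) (use False in auto)
      have neg: "(\<Prod>j<r. var j - ?y) = (- 1) ^ r * (\<Prod>j<r. ?y - var j)"
      proof -
        have "(\<Prod>j<r. var j - ?y) = (\<Prod>j<r. (- 1) * (?y - var j))"
          by (rule prod.cong) simp_all
        then show ?thesis unfolding prod.distrib by simp
      qed
      have sq: "((- 1) ^ r) * ((- 1) ^ r) = (1 :: R)" by (simp flip: power_mult_distrib)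
      have "disc (insert (s i) {..<r}) * (- 1) ^ r
          = ?D * (\<Prod>j<r. ?y - var j) ^ 2 * ((- 1) ^ r * (- 1) ^ r)"
        using False by (simp only: disc_insert neg power2_eq_square mult_ac finite_lessThan lessThan_iff not_False_eq_True)
      then have "(disc (insert (s i) {..<r}) * (- 1) ^ r) ^ k = (?D * (\<Prod>j<r. ?y - var j) ^ 2) ^ k"
        unfolding sq by simp
      then have "disc (insert (s i) {..<r}) ^ k * ((- 1) ^ r) ^ k = ?D ^ k * ((\<Prod>j<r. ?y - var j) ^ 2) ^ k"
        by (simp only: power_mult_distrib)
      also have "\<dots> = ?D ^ k * (\<Prod>j<r. (?y - var j) ^ (2 * k))"
        by (simp only: power_mult[symmetric] prod_power_distrib)
      finally show ?thesis unfolding a using ideal_mult(1)[OF PI m, of "((- 1) ^ r) ^ k"] by (simp only:)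
    qed
  qed
  \<comment> \<open>The power of \<open>?D\<close> makes these ideals lie over \<open>P\<close> even
    after the differences of centers are inverted; applied to \<open>f = 1\<close> it keeps
    \<open>?D\<close> out of \<open>Q\<close>.\<close>
  define \<A> where "\<A> = {Q. stable_ideal r Q \<and> I \<subseteq> Q \<and> (\<forall>f M. ?D ^ M * ?\<phi> f \<in> Q \<longrightarrow> f \<in> P)}"
  have "\<exists>Q\<in>\<A>. \<forall>X\<in>\<A>. Q \<subseteq> X \<longrightarrow> X = Q"
  proof (rule subset_Zorn_nonempty)
    show "\<A> \<noteq> {}" using Ist IP by (auto simp: \<A>_def)
    show "\<Union>C \<in> \<A>" if C: "C \<noteq> {}" "subset.chain \<A> C" for C
    proof -
      have CA: "C \<subseteq> \<A>" using C(2) by (simp add: subset_chain_def)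
      have "ideal.subspace (\<Union>C)"
        by (rule ideal_Union_chain[OF C]) (use CA in \<open>auto simp: \<A>_def stable_ideal_def\<close>)
      moreover have "act \<sigma> f \<in> \<Union>C" if "\<sigma> \<in> perms r" "f \<in> \<Union>C" for \<sigma> f
        using that CA unfolding \<A>_def stable_ideal_def by blast
      moreover have "I \<subseteq> \<Union>C" using C(1) CA by (auto simp: \<A>_def)
      moreover have "f \<in> P" if "?D ^ M * ?\<phi> f \<in> \<Union>C" for f M
        using that CA unfolding \<A>_def by blast
      ultimately show ?thesis unfolding \<A>_def stable_ideal_def by blast
    qed
  qed
  then obtain Q where QA: "Q \<in> \<A>" and max: "\<And>X. X \<in> \<A> \<Longrightarrow> Q \<subseteq> X \<Longrightarrow> X = Q" by blast
  have Q: "stable_ideal r Q" and IQ: "I \<subseteq> Q" and QP: "\<And>f M. ?D ^ M * ?\<phi> f \<in> Q \<Longrightarrow> f \<in> P"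
    using QA by (auto simp: \<A>_def)
  have QI: "ideal.subspace Q" using Q by (simp add: stable_ideal_def)
  have bigger: "\<exists>a M. a \<notin> P \<and> ?D ^ M * ?\<phi> a \<in> ideal.span (Q \<union> orbit r F)" if "F \<notin> Q" for F
  proof (rule ccontr)
    assume no: "\<not> ?thesis"
    have sup: "Q \<subseteq> ideal.span (Q \<union> orbit r F)" "F \<in> ideal.span (Q \<union> orbit r F)"
      using ideal.span_superset[of "Q \<union> orbit r F"] orbit_self[of F r] by auto
    have "stable_ideal r (ideal.span (Q \<union> orbit r F))"
      by (rule stable_ideal_span) (use Q orbit_act in \<open>auto simp: stable_ideal_def\<close>)
    then have "ideal.span (Q \<union> orbit r F) \<in> \<A>"
      using no sup IQ unfolding \<A>_def by blast
    then show False using max sup that by blast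
  qed
  show ?thesis
  proof (rule that[OF Q])
    show "orbit_prime r Q"
      unfolding orbit_prime_def
    proof (intro allI impI, rule ccontr)
      fix F G assume FG: "\<forall>\<sigma>\<in>perms r. F * act \<sigma> G \<in> Q" and "\<not> (F \<in> Q \<or> G \<in> Q)"
      then obtain a b M N where ab: "a \<notin> P" "b \<notin> P"
        "?D ^ M * ?\<phi> a \<in> ideal.span (Q \<union> orbit r F)" "?D ^ N * ?\<phi> b \<in> ideal.span (Q \<union> orbit r G)"
        using bigger by blast
      \<comment> \<open>Enlarging \<open>Q\<close> by the orbit of \<open>F\<close> or of
        \<open>G\<close> reaches elements outside \<open>P\<close>. Since the enlarged ideals are
        stable and multiply into \<open>Q\<close>, this holds for every translate of
        \<open>b\<close>, against primality of \<open>P\<close>.\<close>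
      have "a * act \<sigma> b \<in> P" if "permutation \<sigma>" for \<sigma>
      proof -
        let ?s = "\<lambda>j. if j < r then j else \<sigma> (j - r) + r"
        have s: "?s \<in> perms r" by (rule perms_shift[OF that])
        have "stable_ideal r (ideal.span (Q \<union> orbit r G))"
          by (rule stable_ideal_span) (use Q orbit_act in \<open>auto simp: stable_ideal_def\<close>)
        then have "act ?s (?D ^ N * ?\<phi> b) \<in> ideal.span (Q \<union> orbit r G)"
          using ab(4) s unfolding stable_ideal_def by blast
        then have "(?D ^ M * ?\<phi> a) * act ?s (?D ^ N * ?\<phi> b) \<in> Q"
          using orbit_mult_mem[OF Q _ ab(3)] FG by blast
        moreover have "(?D ^ M * ?\<phi> a) * act ?s (?D ^ N * ?\<phi> b) = ?D ^ (M + N) * ?\<phi> (a * act \<sigma> b)"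
          by (simp add: actD act_act power_add mult_ac)
        ultimately show ?thesis using QP by metis
      qed
      then show False using S_prime_orbit_primeD[OF P] ab by blast
    qed
    show "?D \<notin> Q" using QP[of 1 1] nk[of 0] by auto
    show "?\<phi> f \<in> Q \<longleftrightarrow> f \<in> P" for f using QP[of 0 f] PhiI IQ by auto
    show "(\<Prod>j<r. (var i - var j) ^ (2 * k)) \<in> Q" if "r \<le> i" for i using NI[OF that] IQ by blast
  qed
qed

section \<open>Ideals with centers\<close>

text \<open>Serves to eliminate a variable: two differences \<open>\<xi>\<^sub>i - t\<^sub>a\<close>
  and \<open>\<xi>\<^sub>i - t\<^sub>b\<close> combine to a difference of centers.\<close>

lemma ideal_binomial:
  assumes I: "ideal.subspace I" and a: "a ^ m * h \<in> I" and b: "b ^ n * h \<in> I"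
  shows "(a + b) ^ (m + n) * h \<in> I"
proof -
  have "of_nat (m + n choose i) * a ^ i * b ^ (m + n - i) * h \<in> I" for i
  proof (cases "m \<le> i")
    case True
    then have "a ^ m * h dvd of_nat (m + n choose i) * a ^ i * b ^ (m + n - i) * h"
      by (intro mult_dvd_mono dvd_mult2 dvd_mult le_imp_power_dvd) auto
    then show ?thesis by (rule ideal_dvd[OF I a])
  next
    case False
    then have "b ^ n * h dvd of_nat (m + n choose i) * a ^ i * b ^ (m + n - i) * h"
      by (intro mult_dvd_mono dvd_mult le_imp_power_dvd) auto
    then show ?thesis by (rule ideal_dvd[OF I b])
  qed
  then show ?thesis
    unfolding binomial_ring sum_distrib_right by (intro ideal.subspace_sum[OF I])
qed

lemma enat_unbounded:
  assumes "\<And>n. enat n \<le> x"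
  shows "x = \<infinity>"
proof (cases x)
  case (enat m)
  then show ?thesis using assms[of "Suc m"] by simp
qed simp

lemma multi_partial_cong: "(\<And>i. i \<in> V \<Longrightarrow> \<alpha> i = \<beta> i) \<Longrightarrow> finite V \<Longrightarrow> multi_partial V \<alpha> f = multi_partial V \<beta> f"
  unfolding multi_partial_def by (intro arg_cong[of _ _ "\<lambda>D. partials D f"] map_cong) auto

locale centered =
  fixes P Q :: "R set" and r k :: nat
  assumes stable: "stable_ideal r Q" and prime: "orbit_prime r Q"
    and disc_notin: "disc {..<r} \<notin> Q" and r_pos: "r \<ge> 1"
    and over: "\<And>f. act (\<lambda>i. i + r) f \<in> Q \<longleftrightarrow> f \<in> P"
    and near: "\<And>i. r \<le> i \<Longrightarrow> (\<Prod>j<r. (var i - var j) ^ k) \<in> Q"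
begin

lemma QI: "ideal.subspace Q"
  using stable by (simp add: stable_ideal_def)

lemma one_notin: "1 \<notin> Q"
  using ideal_mult(1)[OF QI, of 1 "disc {..<r}"] disc_notin by auto

lemma act_Q:
  assumes "f \<in> Q" "inj_on s (vars f \<union> {..<r})" "\<And>j. j < r \<Longrightarrow> s j = j"
  shows "act s f \<in> Q"
proof -
  obtain \<tau> where \<tau>: "permutation \<tau>" "\<And>i. i \<in> vars f \<union> {..<r} \<Longrightarrow> \<tau> i = s i"
    using extend_to_permutation[OF _ assms(2)] finite_vars by blast
  then have "\<tau> \<in> perms r" using assms(3) by (auto simp: perms_def)
  then have "act \<tau> f \<in> Q" using stable assms(1) by (auto simp: stable_ideal_def)
  also have "act \<tau> f = act s f" using \<tau> by (intro act_cong) auto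
  finally show ?thesis .
qed

lemma orbit_primeD: "(\<And>\<sigma>. \<sigma> \<in> perms r \<Longrightarrow> f * act \<sigma> g \<in> Q) \<Longrightarrow> f \<in> Q \<or> g \<in> Q"
  using prime unfolding orbit_prime_def by blast

lemma diff_notin: "a < r \<Longrightarrow> b < r \<Longrightarrow> a \<noteq> b \<Longrightarrow> var a - var b \<notin> Q"
  using diff_dvd_disc[of "{..<r}" a b] ideal_dvd[OF QI] disc_notin by auto

text \<open>The group fixes \<open>c\<close>, so for \<open>f\<close> and \<open>c\<close>
  equivariant primality is ordinary primality.\<close>

lemma cancel:
  assumes "vars c \<subseteq> {..<r}" "c * f \<in> Q"
  shows "c \<in> Q \<or> f \<in> Q"
proof -
  have "f * act \<sigma> c \<in> Q" if "\<sigma> \<in> perms r" for \<sigma>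
  proof -
    have "act \<sigma> c = c" by (rule act_ident) (use that assms in \<open>auto simp: perms_def\<close>)
    then show ?thesis using assms(2) by (simp add: mult.commute)
  qed
  then show ?thesis using orbit_primeD by blast
qed

lemma power_notin:
  assumes "vars c \<subseteq> {..<r}" "c \<notin> Q"
  shows "c ^ n \<notin> Q"
proof (induction n)
  case 0
  then show ?case using one_notin by simp
next
  case (Suc n)
  then show ?case using cancel[of c "c ^ n"] assms by auto
qed

text \<open>Near \<open>t\<^sub>j\<close> the second factor is invertible, and near every other center it vanishes: up to
  units \<open>u j a i\<close> is the product of \<open>(\<xi>\<^sub>i - t\<^sub>j)\<^sup>a\<close> and the idempotent of the condition that \<open>\<xi>\<^sub>i\<close> is
  near \<open>t\<^sub>j\<close>. Avoiding the idempotents themselves avoids denominators.\<close>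

definition u :: "nat \<Rightarrow> nat \<Rightarrow> nat \<Rightarrow> R" where
  "u j a i = (var i - var j) ^ a * (\<Prod>l\<in>{..<r} - {j}. (var i - var l) ^ k)"

lemma vars_u:
  assumes "j < r"
  shows "vars (u j a i) \<subseteq> insert i {..<r}"
proof -
  have d: "vars ((var i - var l) ^ m) \<subseteq> insert i {..<r}" if "l < r" for l m
    using that vars_power[of "var i - var l" m] vars_minus[of "var i" "var l"] by auto
  have "vars (\<Prod>l\<in>{..<r} - {j}. (var i - var l) ^ k) \<subseteq> insert i {..<r}"
    by (intro order_trans[OF vars_prod] UN_least d) auto
  then show ?thesis
    unfolding u_def using d[OF assms] by (intro order_trans[OF vars_mult] Un_least)
qed

lemma act_u: "(\<And>l. l < r \<Longrightarrow> s l = l) \<Longrightarrow> j < r \<Longrightarrow> act s (u j a i) = u j a (s i)"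
  by (simp add: u_def)

lemma u_mono: "a \<le> b \<Longrightarrow> u j a i \<in> Q \<Longrightarrow> u j b i \<in> Q"
  by (rule ideal_dvd[OF QI]) (auto simp: u_def intro!: mult_dvd_mono le_imp_power_dvd)

lemma u_shift: "(var i - var j) ^ b * u j a i = u j (b + a) i"
  by (simp add: u_def power_add mult.assoc)

lemma u_mult_same: "u j (a + b) i dvd u j a i * u j b i"
  unfolding u_def power_add mult.assoc[symmetric] by (simp add: mult_ac)

lemma u_k: "j < r \<Longrightarrow> r \<le> i \<Longrightarrow> u j k i \<in> Q"
  using near[of i] by (simp add: u_def prod.remove[of "{..<r}" j])

text \<open>A variable cannot be near two centers: \<open>u l b i\<close> contains
  \<open>(\<xi>\<^sub>i - t\<^sub>j)\<^sup>k\<close>, which completes \<open>u j a i\<close> to a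
  multiple of \<open>u j k i\<close>.\<close>

lemma u_orth:
  assumes "j \<noteq> l" "j < r" "l < r" "r \<le> i"
  shows "u j a i * u l b i \<in> Q"
proof -
  have "(var i - var j) ^ k dvd (\<Prod>m\<in>{..<r} - {l}. (var i - var m) ^ k)"
    by (rule dvd_prodI) (use assms in auto)
  then have "u j k i dvd u l b i * u j a i"
    unfolding u_def by (intro mult_dvd_mono dvd_mult) auto
  then show ?thesis using ideal_dvd[OF QI u_k] assms by (simp add: mult.commute)
qed

lemma u_any:
  assumes "j < r" "r \<le> i" "r \<le> i'" "u j a i \<in> Q"
  shows "u j a i' \<in> Q"
proof -
  let ?s = "\<lambda>x. if x = i then i' else x"
  have "inj_on ?s (insert i {..<r})" using assms by (auto simp: inj_on_def)
  then have "inj_on ?s (vars (u j a i) \<union> {..<r})"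
    by (rule inj_on_subset) (use vars_u[OF assms(1), of a i] in auto)
  then have "act ?s (u j a i) \<in> Q" by (rule act_Q[OF assms(4)]) (use assms in auto)
  then show ?thesis using act_u[of ?s j a i] assms by auto
qed

section \<open>Weights and capacities of the centers\<close>

definition wt :: "nat \<Rightarrow> nat" where
  "wt j = (LEAST a. u j a r \<in> Q)"

text \<open>The minimum exists and is at most \<open>k\<close> by \<open>u_k\<close>, and by
  \<open>u_any\<close> all old variables give the same one. Weight 0 means that already
  \<open>u j 0 i\<close> lies in \<open>Q\<close>.\<close>

lemma wt_mem: "j < r \<Longrightarrow> r \<le> i \<Longrightarrow> wt j \<le> a \<Longrightarrow> u j a i \<in> Q"
  using LeastI[of "\<lambda>a. u j a r \<in> Q" k] u_k[of j r] u_any[of j r i] u_mono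
  unfolding wt_def[symmetric] by blast

lemma wt_notin: "j < r \<Longrightarrow> r \<le> i \<Longrightarrow> a < wt j \<Longrightarrow> u j a i \<notin> Q"
  using not_less_Least[of a "\<lambda>a. u j a r \<in> Q"] u_any[of j i r] unfolding wt_def by blast

text \<open>The highest surviving power for each variable of \<open>A\<close>, the analogue of a
  socle generator in a tensor product of truncated polynomial rings. For weight 0 the truncated
  \<open>wt j - 1\<close> is 0, and the factors at old variables already lie in
  \<open>Q\<close>.\<close>

definition top_prod :: "nat \<Rightarrow> nat set \<Rightarrow> R" where
  "top_prod j A = (\<Prod>i\<in>A. u j (wt j - 1) i)"

lemma vars_top_prod: "j < r \<Longrightarrow> vars (top_prod j A) \<subseteq> A \<union> {..<r}"
  unfolding top_prod_def using vars_u by (intro order_trans[OF vars_prod] UN_least) fastforce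

lemma act_top_prod:
  assumes "\<And>l. l < r \<Longrightarrow> s l = l" "j < r" "inj_on s A"
  shows "act s (top_prod j A) = top_prod j (s ` A)"
  using assms by (simp add: top_prod_def act_u prod.reindex)

lemma top_prod_dvd: "finite B \<Longrightarrow> A \<subseteq> B \<Longrightarrow> top_prod j A dvd top_prod j B"
  unfolding top_prod_def by (rule prod_dvd_prod_subset)

lemma u_dvd_top_prod: "finite A \<Longrightarrow> i \<in> A \<Longrightarrow> u j (wt j - 1) i dvd top_prod j A"
  unfolding top_prod_def by (rule dvd_prodI)

text \<open>Only the size matters: an injection of \<open>A\<close> into \<open>B\<close> is a
  renaming that fixes the centers, and the product over its image divides the product over
  \<open>B\<close>.\<close>

lemma top_prod_mono:
  assumes j: "j < r" and A: "finite A" "A \<subseteq> {r..}" and B: "finite B" "B \<subseteq> {r..}"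
    and c: "card A \<le> card B" and t: "top_prod j A \<in> Q"
  shows "top_prod j B \<in> Q"
proof -
  obtain g where g: "inj_on g A" "g ` A \<subseteq> B"
    using card_le_inj[OF A(1) B(1) c] by blast
  let ?s = "\<lambda>x. if x < r then x else g x"
  have gs: "?s x = g x" if "x \<in> A" for x using that A by auto
  have inj: "inj_on ?s (A \<union> {..<r})"
  proof (rule inj_onI)
    fix x y assume xy: "x \<in> A \<union> {..<r}" "y \<in> A \<union> {..<r}" "?s x = ?s y"
    have *: "r \<le> g x" if "x \<in> A" for x using that g B by auto
    show "x = y"
      using xy A *[of x] *[of y] inj_onD[OF g(1), of x y] by (auto split: if_splits)
  qed
  have "act ?s (top_prod j A) \<in> Q"
    by (rule act_Q[OF t]) (use inj vars_top_prod[OF j, of A] in \<open>auto intro: inj_on_subset\<close>)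
  moreover have "act ?s (top_prod j A) = top_prod j (g ` A)"
    using inj j gs by (subst act_top_prod) (auto intro: inj_on_subset cong: image_cong)
  ultimately show ?thesis using top_prod_dvd[OF B(1) g(2)] ideal_dvd[OF QI] by simp
qed

definition cap :: "nat \<Rightarrow> enat" where
  "cap j = Sup {enat (card A) | A. finite A \<and> A \<subseteq> {r..} \<and> top_prod j A \<notin> Q}"

text \<open>By \<open>top_prod_mono\<close> the sizes whose product avoids \<open>Q\<close> form an
  initial segment, which contains 0 because 1 is not in \<open>Q\<close>; so the supremum
  decides.\<close>

lemma top_prod_notin_iff:
  assumes "j < r" "finite A" "A \<subseteq> {r..}"
  shows "top_prod j A \<notin> Q \<longleftrightarrow> enat (card A) \<le> cap j"
proof
  show "enat (card A) \<le> cap j" if "top_prod j A \<notin> Q"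
    unfolding cap_def by (rule Sup_upper) (use that assms in auto)
  show "top_prod j A \<notin> Q" if le: "enat (card A) \<le> cap j"
  proof
    assume t: "top_prod j A \<in> Q"
    have less: "card B < card A" if "finite B" "B \<subseteq> {r..}" "top_prod j B \<notin> Q" for B
      using top_prod_mono[OF assms that(1,2) _ t] that(3) by force
    have "card A \<noteq> 0" using t one_notin assms by (auto simp: top_prod_def)
    have "cap j \<le> enat (card A - 1)"
      unfolding cap_def by (rule Sup_least) (use less in fastforce)
    then have "enat (card A) \<le> enat (card A - 1)" using le by (rule order_trans[rotated])
    then show False using \<open>card A \<noteq> 0\<close> by simp
  qed
qed

text \<open>If \<open>f\<close> is a product of \<open>n\<close> top powers and \<open>wt j \<ge> 2\<close>, then \<open>f\<close> times a translate of \<open>f\<close>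
  is killed by any overlap of the variables, and otherwise has more than \<open>n\<close> factors.\<close>

lemma cap_infinite:
  assumes j: "j < r" and w: "wt j \<ge> 2"
  shows "cap j = \<infinity>"
proof -
  have "\<forall>A. finite A \<longrightarrow> A \<subseteq> {r..} \<longrightarrow> card A = n \<longrightarrow> top_prod j A \<notin> Q" for n
  proof (induction n)
    case 0
    then show ?case using one_notin by (auto simp: top_prod_def)
  next
    case (Suc n)
    show ?case
    proof (intro allI impI notI)
      fix A assume A: "finite A" "A \<subseteq> {r..}" "card A = Suc n" "top_prod j A \<in> Q"
      then obtain i B where B: "A = insert i B" "i \<notin> B" "finite B" "card B = n"
        by (metis card_Suc_eq_finite)
      have tB: "top_prod j B \<notin> Q" using Suc B A by auto
      show False
      proof (cases "n = 0")
        case True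
        then show False using A B wt_notin[OF j, of i "wt j - 1"] w by (auto simp: top_prod_def)
      next
        case False
        have "top_prod j B * act \<sigma> (top_prod j B) \<in> Q" if s: "\<sigma> \<in> perms r" for \<sigma>
        proof -
          have inj: "inj_on \<sigma> B" using perms_inj[OF s] by (auto intro: inj_on_subset)
          have act: "act \<sigma> (top_prod j B) = top_prod j (\<sigma> ` B)"
            by (rule act_top_prod) (use s j inj in \<open>auto simp: perms_def\<close>)
          have sub: "\<sigma> ` B \<subseteq> {r..}" using perms_ge[OF s] A B by auto
          show ?thesis
          proof (cases "B \<inter> \<sigma> ` B = {}")
            case True
            then have c: "card (B \<union> \<sigma> ` B) = n + n"
              using B inj by (simp add: card_Un_disjoint card_image)
            have "top_prod j (B \<union> \<sigma> ` B) \<in> Q"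
              by (rule top_prod_mono[OF j A(1,2) _ _ _ A(4)]) (use B A sub c \<open>n \<noteq> 0\<close> in auto)
            then show ?thesis unfolding act using True B by (simp add: top_prod_def prod.union_disjoint)
          next
            case False
            then obtain x where x: "x \<in> B" "x \<in> \<sigma> ` B" by blast
            let ?a = "wt j - 1"
            \<comment> \<open>\<open>2 * (wt j - 1)\<close> is at least \<open>wt j\<close> because
              \<open>wt j \<ge> 2\<close>: a repeated variable kills the product.\<close>
            have "u j (?a + ?a) x \<in> Q" by (rule wt_mem[OF j]) (use x A B w in auto)
            then have "u j ?a x * u j ?a x \<in> Q" using u_mult_same by (rule ideal_dvd[OF QI])
            then show ?thesis unfolding act
              by (rule ideal_dvd[OF QI]) (use x B in \<open>blast intro: mult_dvd_mono u_dvd_top_prod finite_imageI\<close>)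
          qed
        qed
        then show False using orbit_primeD tB by blast
      qed
    qed
  qed
  then have "enat n \<le> cap j" for n
    using top_prod_notin_iff[OF j, of "{r..<r + n}"] by (simp add: subset_iff)
  then show ?thesis by (rule enat_unbounded)
qed

text \<open>One center is added at a time. A translate of the new factor that meets a variable used
  at another center is killed by \<open>u_orth\<close>; any other translate times \<open>?F\<close>
  is a renaming of the full product. So if the full product were in \<open>Q\<close>, primality
  would put one of its two factors there.\<close>

lemma top_prod_joint:
  assumes "finite J" "J \<subseteq> {..<r}" "\<And>j. j \<in> J \<Longrightarrow> finite (A j) \<and> A j \<subseteq> {r..} \<and> top_prod j (A j) \<notin> Q"
    "\<And>j l. j \<in> J \<Longrightarrow> l \<in> J \<Longrightarrow> j \<noteq> l \<Longrightarrow> A j \<inter> A l = {}"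
  shows "(\<Prod>j\<in>J. top_prod j (A j)) \<notin> Q"
  using assms
proof (induction J rule: finite_induct)
  case empty
  then show ?case using one_notin by simp
next
  case (insert j J)
  let ?F = "\<Prod>j\<in>J. top_prod j (A j)" and ?G = "top_prod j (A j)"
  have jr: "j < r" and Aj: "finite (A j)" "A j \<subseteq> {r..}" "?G \<notin> Q" using insert by auto
  have F: "?F \<notin> Q" by (rule insert.IH) (use insert.prems in auto)
  have vF: "vars ?F \<subseteq> (\<Union>l\<in>J. A l) \<union> {..<r}"
    using vars_top_prod insert.prems(1) by (intro order_trans[OF vars_prod] UN_least) fastforce
  show ?case
  proof
    assume "(\<Prod>j\<in>insert j J. top_prod j (A j)) \<in> Q"
    then have FG: "?F * ?G \<in> Q" using insert.hyps by (simp add: mult.commute)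
    have "?F * act \<sigma> ?G \<in> Q" if s: "\<sigma> \<in> perms r" for \<sigma>
    proof -
      have inj: "inj \<sigma>" by (rule perms_inj[OF s])
      have fixes_centers: "\<And>l. l < r \<Longrightarrow> \<sigma> l = l" using s by (simp add: perms_def)
      have act: "act \<sigma> ?G = top_prod j (\<sigma> ` A j)"
        by (rule act_top_prod) (use fixes_centers jr inj in \<open>auto intro: inj_on_subset\<close>)
      show ?thesis
      proof (cases "\<sigma> ` A j \<inter> (\<Union>l\<in>J. A l) = {}")
        case True
        \<comment> \<open>\<open>\<sigma>\<close> is applied to the variables of the new factor
          only, so that \<open>?F\<close> stays fixed.\<close>
        let ?s = "\<lambda>x. if x \<in> A j then \<sigma> x else x"
        have notin: "x \<notin> A j" if "x \<in> (\<Union>l\<in>J. A l) \<union> {..<r}" for x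
          using that Aj insert.prems(3)[of j] insert.hyps by fastforce
        have inj_s: "inj_on ?s ((\<Union>l\<in>J. A l) \<union> {..<r} \<union> A j)"
        proof (rule inj_onI)
          fix x y assume xy: "x \<in> (\<Union>l\<in>J. A l) \<union> {..<r} \<union> A j" "y \<in> (\<Union>l\<in>J. A l) \<union> {..<r} \<union> A j" "?s x = ?s y"
          have *: "\<sigma> x \<noteq> y" if "x \<in> A j" "y \<notin> A j" "y \<in> (\<Union>l\<in>J. A l) \<union> {..<r} \<union> A j" for x y
            using that True perms_ge[OF s, of x] Aj by fastforce
          show "x = y" using xy *[of x y] *[of y x] injD[OF inj, of x y] by (auto split: if_splits)
        qed
        have "vars (?F * ?G) \<union> {..<r} \<subseteq> (\<Union>l\<in>J. A l) \<union> {..<r} \<union> A j"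
          using vars_mult[of ?F ?G] vF vars_top_prod[OF jr, of "A j"] by blast
        then have "act ?s (?F * ?G) \<in> Q"
          by (intro act_Q[OF FG] inj_on_subset[OF inj_s]) (use Aj in auto)
        moreover have "act ?s ?F = ?F" by (rule act_ident) (use vF notin in auto)
        moreover have "act ?s ?G = act \<sigma> ?G"
          by (rule act_cong) (use vars_top_prod[OF jr, of "A j"] fixes_centers in auto)
        ultimately show ?thesis by simp
      next
        case False
        then obtain x l where x: "x \<in> \<sigma> ` A j" "l \<in> J" "x \<in> A l" by blast
        have l: "l \<noteq> j" "l < r" "finite (A l)" "A l \<subseteq> {r..}" using x insert by auto
        have "u l (wt l - 1) x * u j (wt j - 1) x \<in> Q"
          by (rule u_orth) (use x l jr in auto)
        moreover have "top_prod l (A l) dvd ?F" by (rule dvd_prodI) (use insert x in auto)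
        then have "u l (wt l - 1) x dvd ?F" by (rule dvd_trans[OF u_dvd_top_prod[OF l(3) x(3)]])
        then have "u l (wt l - 1) x * u j (wt j - 1) x dvd ?F * act \<sigma> ?G"
          unfolding act using x Aj by (intro mult_dvd_mono u_dvd_top_prod) auto
        ultimately show ?thesis by (rule ideal_dvd[OF QI])
      qed
    qed
    then show False using orbit_primeD F Aj(3) by blast
  qed
qed

section \<open>Assignments of variables to centers, and a partition of unity\<close>

definition allowed :: "nat set \<Rightarrow> (nat \<Rightarrow> nat) \<Rightarrow> bool" where
  "allowed V \<pi> \<longleftrightarrow> (\<forall>j<r. enat (card {i \<in> V. \<pi> i = j}) \<le> cap j)"

lemma prod_top_group:
  assumes "finite V" "\<And>i. i \<in> V \<Longrightarrow> \<pi> i < r"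
  shows "(\<Prod>i\<in>V. u (\<pi> i) (wt (\<pi> i) - 1) (i + r)) = (\<Prod>j<r. top_prod j ((\<lambda>i. i + r) ` {i \<in> V. \<pi> i = j}))"
proof -
  have "top_prod j ((\<lambda>i. i + r) ` {i \<in> V. \<pi> i = j}) = (\<Prod>i\<in>{i \<in> V. \<pi> i = j}. u (\<pi> i) (wt (\<pi> i) - 1) (i + r))" for j
    unfolding top_prod_def by (subst prod.reindex) (auto simp: inj_on_def)
  then show ?thesis
    using prod.group[OF assms(1) finite_lessThan, of \<pi> r "\<lambda>i. u (\<pi> i) (wt (\<pi> i) - 1) (i + r)"] assms(2)
    by (simp only: image_subset_iff lessThan_iff) auto
qed

lemma card_shift: "card ((\<lambda>i. i + r) ` A) = card A"
  by (rule card_image) (auto simp: inj_on_def)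

text \<open>Grouping by centers reduces this to \<open>top_prod_joint\<close>. The product is the
  multiplier that later isolates a Taylor coefficient.\<close>

lemma top_notin:
  assumes V: "finite V" "\<And>i. i \<in> V \<Longrightarrow> \<pi> i < r" and a: "allowed V \<pi>"
  shows "(\<Prod>i\<in>V. u (\<pi> i) (wt (\<pi> i) - 1) (i + r)) \<notin> Q"
proof (subst prod_top_group[OF V(1)])
  show "(\<Prod>j<r. top_prod j ((\<lambda>i. i + r) ` {i \<in> V. \<pi> i = j})) \<notin> Q"
  proof (rule top_prod_joint)
  fix j assume "j \<in> {..<r}"
  then show "finite ((\<lambda>i. i + r) ` {i \<in> V. \<pi> i = j}) \<and> (\<lambda>i. i + r) ` {i \<in> V. \<pi> i = j} \<subseteq> {r..}
      \<and> top_prod j ((\<lambda>i. i + r) ` {i \<in> V. \<pi> i = j}) \<notin> Q"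
    using a V(1) by (subst top_prod_notin_iff) (auto simp: allowed_def card_shift)
  qed auto
qed (rule V(2))

text \<open>Up to powers of differences of centers, which can be cancelled, the elements
  \<open>u j 0 i\<close> generate the unit ideal. The induction removes factors: adding
  \<open>a\<close> to \<open>S\<close> and adding \<open>b\<close> to \<open>S\<close> together give
  \<open>S\<close>, down to the empty set.\<close>

lemma bezout:
  assumes "\<And>j. j < r \<Longrightarrow> F * u j 0 i \<in> Q"
  shows "F \<in> Q"
proof -
  let ?W = "\<lambda>S. \<Prod>l\<in>S. (var i - var l) ^ k"
  have "\<forall>S. S \<subseteq> {..<r} \<longrightarrow> card ({..<r} - S) = Suc n \<longrightarrow> F * ?W S \<in> Q" for n
  proof (induction n)
    case 0
    show ?case
    proof (intro allI impI)
      fix S assume S: "S \<subseteq> {..<r}" "card ({..<r} - S) = Suc 0"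
      then obtain j where "{..<r} - S = {j}" by (metis card_1_singletonE One_nat_def)
      then have "S = {..<r} - {j}" "j < r" using S by auto
      then show "F * ?W S \<in> Q" using assms[of j] by (simp add: u_def)
    qed
  next
    case (Suc n)
    show ?case
    proof (intro allI impI)
      fix S assume S: "S \<subseteq> {..<r}" "card ({..<r} - S) = Suc (Suc n)"
      have fin: "finite S" using S by (auto intro: finite_subset)
      have "\<exists>a b. a \<in> {..<r} - S \<and> b \<in> {..<r} - S \<and> a \<noteq> b"
        using S(2) card_le_Suc0_iff_eq[of "{..<r} - S"] by auto
      then obtain a b where ab: "a \<in> {..<r} - S" "b \<in> {..<r} - S" "a \<noteq> b" by blast
      have step: "(var i - var c) ^ k * (F * ?W S) \<in> Q" if c: "c \<in> {..<r} - S" for c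
      proof -
        have "{..<r} - insert c S = ({..<r} - S) - {c}" by auto
        then have "card ({..<r} - insert c S) = Suc n" using S(2) c by simp
        then have "F * ?W (insert c S) \<in> Q" using Suc S c by auto
        then show ?thesis using fin c by (simp add: mult_ac)
      qed
      \<comment> \<open>With this sign the two bases add up to \<open>t\<^sub>a - t\<^sub>b\<close>,
        which no longer involves \<open>\<xi>\<^sub>i\<close>.\<close>
      have "(- (var i - var a)) ^ k * (F * ?W S) \<in> Q"
        using ideal_mult(2)[OF QI step[OF ab(1)], of "(- 1) ^ k"]
        by (simp only: power_minus[of "var i - var a"] mult.assoc)
      from ideal_binomial[OF QI this step[OF ab(2)]]
      have "(var a - var b) ^ (k + k) * (F * ?W S) \<in> Q" by simp
      moreover have v: "vars (var a - var b) \<subseteq> {..<r}" using vars_minus[of "var a" "var b"] ab by auto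
      then have "vars ((var a - var b) ^ (k + k)) \<subseteq> {..<r}" using vars_power by blast
      moreover have "(var a - var b) ^ (k + k) \<notin> Q"
        by (rule power_notin[OF v]) (use diff_notin ab in auto)
      ultimately show "F * ?W S \<in> Q" using cancel by blast
    qed
  qed
  from this[of "r - 1"] show ?thesis using r_pos by (auto dest!: spec[of _ "{}"])
qed

text \<open>In effect the idempotents of the centers sum to 1 for each variable; multiplied out over
  \<open>V\<close>, membership can be tested for one assignment at a time.\<close>

lemma bezout_multi:
  assumes "finite V" "\<And>\<pi>. (\<And>i. i \<in> V \<Longrightarrow> \<pi> i < r) \<Longrightarrow> F * (\<Prod>i\<in>V. u (\<pi> i) 0 (i + r)) \<in> Q"
  shows "F \<in> Q"
  using assms
proof (induction V arbitrary: F rule: finite_induct)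
  case empty
  then show ?case by simp
next
  case (insert i V)
  show ?case
  proof (rule insert.IH)
    fix \<pi> assume p: "\<And>i. i \<in> V \<Longrightarrow> \<pi> i < r"
    show "F * (\<Prod>i\<in>V. u (\<pi> i) 0 (i + r)) \<in> Q"
    proof (rule bezout[of _ "i + r"])
      fix j assume "j < r"
      let ?p = "\<pi>(i := j)"
      have "F * (\<Prod>i\<in>insert i V. u (?p i) 0 (i + r)) \<in> Q"
        by (rule insert.prems) (use p \<open>j < r\<close> in auto)
      moreover have "(\<Prod>i\<in>V. u (?p i) 0 (i + r)) = (\<Prod>i\<in>V. u (\<pi> i) 0 (i + r))"
        using insert.hyps by (intro prod.cong) auto
      ultimately show "F * (\<Prod>i\<in>V. u (\<pi> i) 0 (i + r)) * u j 0 (i + r) \<in> Q"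
        using insert.hyps by (simp add: mult_ac)
    qed
  qed
qed

text \<open>An overfull center has finite capacity, hence weight at most 1 by
  \<open>cap_infinite\<close>; there the top power is \<open>u j 0\<close>, and the definition of
  the capacity applies.\<close>

lemma disallowed_mem:
  assumes V: "finite V" "\<And>i. i \<in> V \<Longrightarrow> \<pi> i < r"
    and d: "(\<exists>i\<in>V. wt (\<pi> i) = 0) \<or> \<not> allowed V \<pi>"
  shows "(\<Prod>i\<in>V. u (\<pi> i) 0 (i + r)) \<in> Q"
  using d
proof
  assume "\<exists>i\<in>V. wt (\<pi> i) = 0"
  then obtain i where i: "i \<in> V" "wt (\<pi> i) = 0" by blast
  then have "u (\<pi> i) 0 (i + r) \<in> Q" using V by (intro wt_mem) auto
  then show ?thesis by (rule ideal_dvd[OF QI]) (use i V in \<open>auto intro: dvd_prodI\<close>)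
next
  assume "\<not> allowed V \<pi>"
  then obtain j where j: "j < r" "\<not> enat (card {i \<in> V. \<pi> i = j}) \<le> cap j" by (auto simp: allowed_def)
  let ?A = "{i \<in> V. \<pi> i = j}"
  have "\<not> wt j \<ge> 2" using cap_infinite[OF j(1)] j(2) by auto
  then have w: "wt j - 1 = 0" by simp
  have "top_prod j ((\<lambda>i. i + r) ` ?A) \<in> Q"
    using top_prod_notin_iff[OF j(1), of "(\<lambda>i. i + r) ` ?A"] j V by (simp add: card_shift image_subset_iff)
  moreover have "top_prod j ((\<lambda>i. i + r) ` ?A) = (\<Prod>i\<in>?A. u (\<pi> i) 0 (i + r))"
    unfolding top_prod_def w by (subst prod.reindex) (auto simp: inj_on_def)
  moreover have "(\<Prod>i\<in>?A. u (\<pi> i) 0 (i + r)) dvd (\<Prod>i\<in>V. u (\<pi> i) 0 (i + r))"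
    by (rule prod_dvd_prod_subset) (use V in auto)
  ultimately show ?thesis using ideal_dvd[OF QI] by simp
qed

section \<open>Membership in \<open>P\<close> through Taylor coefficients at the centers\<close>

lemma taylor_times_u:
  assumes "finite V" "vars f \<subseteq> V"
  obtains N0 where "\<And>N \<pi> b. N0 \<le> N \<Longrightarrow> act (\<lambda>i. i + r) f * (\<Prod>i\<in>V. u (\<pi> i) (b i) (i + r))
     = (\<Sum>\<beta>\<in>PiE V (\<lambda>_. {..N}). const (inverse (alpha_fact V \<beta>)) * act \<pi> (multi_partial V \<beta> f)
         * (\<Prod>i\<in>V. u (\<pi> i) (\<beta> i + b i) (i + r)))"
proof -
  obtain N0 where N0: "\<And>N s s'. N0 \<le> N \<Longrightarrow> act s' f = (\<Sum>\<alpha>\<in>PiE V (\<lambda>_. {..N}).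
     const (inverse (alpha_fact V \<alpha>)) * act s (multi_partial V \<alpha> f) * (\<Prod>i\<in>V. (var (s' i) - var (s i)) ^ \<alpha> i))"
    using taylor[OF assms] by blast
  show ?thesis
  proof (rule that)
    fix N \<pi> and b :: "nat \<Rightarrow> nat" assume "N0 \<le> N"
    then show "act (\<lambda>i. i + r) f * (\<Prod>i\<in>V. u (\<pi> i) (b i) (i + r))
     = (\<Sum>\<beta>\<in>PiE V (\<lambda>_. {..N}). const (inverse (alpha_fact V \<beta>)) * act \<pi> (multi_partial V \<beta> f)
         * (\<Prod>i\<in>V. u (\<pi> i) (\<beta> i + b i) (i + r)))"
      by (subst N0[where s = \<pi>], assumption)
        (simp only: sum_distrib_right mult.assoc prod.distrib[symmetric] u_shift)
  qed
qed

text \<open>The multiplier has exponents complementary to \<open>\<alpha>\<close>. It pushes every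
  term with some \<open>\<beta> i > \<alpha> i\<close> up to the weight, the terms below
  \<open>\<alpha>\<close> are covered by induction on the total order, and the term of
  \<open>\<alpha>\<close> becomes its coefficient times the top product, which avoids
  \<open>Q\<close> and is removed by \<open>cancel\<close>.\<close>

lemma taylor_coeff_mem:
  assumes f: "f \<in> P" and V: "finite V" "vars f \<subseteq> V"
    and \<pi>: "\<And>i. i \<in> V \<Longrightarrow> \<pi> i < r" "allowed V \<pi>"
    and \<alpha>: "\<And>i. i \<in> V \<Longrightarrow> \<alpha> i < wt (\<pi> i)"
  shows "act \<pi> (multi_partial V \<alpha> f) \<in> Q"
  using \<alpha>
proof (induction "\<Sum>i\<in>V. \<alpha> i" arbitrary: \<alpha> rule: less_induct)
  case less
  obtain N0 where N0: "\<And>N \<pi> b. N0 \<le> N \<Longrightarrow> act (\<lambda>i. i + r) f * (\<Prod>i\<in>V. u (\<pi> i) (b i) (i + r))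
     = (\<Sum>\<beta>\<in>PiE V (\<lambda>_. {..N}). const (inverse (alpha_fact V \<beta>)) * act \<pi> (multi_partial V \<beta> f)
         * (\<Prod>i\<in>V. u (\<pi> i) (\<beta> i + b i) (i + r)))"
    using taylor_times_u[OF V] by blast
  \<comment> \<open>Large enough for \<open>\<alpha>\<close> to occur among the exponents of the
    expansion.\<close>
  define N where "N = N0 + (\<Sum>i\<in>V. \<alpha> i)"
  define b where "b i = wt (\<pi> i) - 1 - \<alpha> i" for i
  let ?t = "\<lambda>\<beta>. const (inverse (alpha_fact V \<beta>)) * act \<pi> (multi_partial V \<beta> f)
         * (\<Prod>i\<in>V. u (\<pi> i) (\<beta> i + b i) (i + r))"
  let ?E = "PiE V (\<lambda>_. {..N})"
  let ?\<alpha> = "restrict \<alpha> V"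
  have "?\<alpha> \<in> ?E" using V(1) by (auto simp: N_def intro!: trans_le_add2 member_le_sum)
  have finE: "finite ?E" using V by (auto intro: finite_PiE)
  have "(\<Sum>\<beta>\<in>?E. ?t \<beta>) \<in> Q"
  proof -
    have "act (\<lambda>i. i + r) f * (\<Prod>i\<in>V. u (\<pi> i) (b i) (i + r)) \<in> Q"
      by (intro ideal_mult[OF QI]) (use over f in auto)
    then show ?thesis by (subst (asm) N0[of N]) (auto simp: N_def)
  qed
  then have "?t ?\<alpha> + (\<Sum>\<beta>\<in>?E - {?\<alpha>}. ?t \<beta>) \<in> Q"
    by (subst (asm) sum.remove[OF finE \<open>?\<alpha> \<in> ?E\<close>])
  moreover have "(\<Sum>\<beta>\<in>?E - {?\<alpha>}. ?t \<beta>) \<in> Q"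
  proof (rule ideal.subspace_sum[OF QI])
    fix \<beta> assume b: "\<beta> \<in> ?E - {?\<alpha>}"
    show "?t \<beta> \<in> Q"
    proof (cases "\<exists>i\<in>V. \<alpha> i < \<beta> i")
      case True
      then obtain i where i: "i \<in> V" "\<alpha> i < \<beta> i" by blast
      then have "u (\<pi> i) (\<beta> i + b i) (i + r) \<in> Q"
        using \<pi> less.prems[of i] by (intro wt_mem) (auto simp: b_def)
      then have "(\<Prod>i\<in>V. u (\<pi> i) (\<beta> i + b i) (i + r)) \<in> Q"
        by (rule ideal_dvd[OF QI]) (use i V in \<open>auto intro: dvd_prodI\<close>)
      then show ?thesis by (rule ideal_mult[OF QI])
    next
      case False
      then have le: "\<And>i. i \<in> V \<Longrightarrow> \<beta> i \<le> \<alpha> i" by force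
      have "\<exists>i\<in>V. \<beta> i \<noteq> \<alpha> i"
      proof (rule ccontr)
        assume "\<not> ?thesis"
        then have "\<beta> = ?\<alpha>" using b by (intro ext) (auto simp: PiE_def extensional_def)
        then show False using b by simp
      qed
      then have "(\<Sum>i\<in>V. \<beta> i) < (\<Sum>i\<in>V. \<alpha> i)"
        using le V(1) by (intro sum_strict_mono_ex1) (blast intro: le_neq_implies_less)+
      then have "act \<pi> (multi_partial V \<beta> f) \<in> Q"
        by (rule less.hyps) (use le less.prems in \<open>auto intro: le_less_trans\<close>)
      then show ?thesis by (intro ideal_mult[OF QI])
    qed
  qed
  ultimately have "?t ?\<alpha> \<in> Q"
    using ideal_cong[OF QI, of "?t ?\<alpha> + (\<Sum>\<beta>\<in>?E - {?\<alpha>}. ?t \<beta>)" "?t ?\<alpha>"] by simp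
  moreover have "(\<Prod>i\<in>V. u (\<pi> i) (?\<alpha> i + b i) (i + r)) = (\<Prod>i\<in>V. u (\<pi> i) (wt (\<pi> i) - 1) (i + r))"
  proof (rule prod.cong[OF refl])
    fix i assume "i \<in> V"
    then have "?\<alpha> i + b i = wt (\<pi> i) - 1" using less.prems[of i] by (simp add: b_def)
    then show "u (\<pi> i) (?\<alpha> i + b i) (i + r) = u (\<pi> i) (wt (\<pi> i) - 1) (i + r)" by simp
  qed
  moreover have "act \<pi> (multi_partial V ?\<alpha> f) = act \<pi> (multi_partial V \<alpha> f)"
    using multi_partial_cong[of V ?\<alpha> \<alpha> f] V by simp
  ultimately have "const (inverse (alpha_fact V ?\<alpha>)) * act \<pi> (multi_partial V \<alpha> f)
      * (\<Prod>i\<in>V. u (\<pi> i) (wt (\<pi> i) - 1) (i + r)) \<in> Q" by simp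
  from ideal_mult(2)[OF QI this, of "const (alpha_fact V ?\<alpha>)"]
  have "(const (inverse (alpha_fact V ?\<alpha>)) * const (alpha_fact V ?\<alpha>)) * (act \<pi> (multi_partial V \<alpha> f)
      * (\<Prod>i\<in>V. u (\<pi> i) (wt (\<pi> i) - 1) (i + r))) \<in> Q" by (simp only: mult_ac)
  then have "act \<pi> (multi_partial V \<alpha> f) * (\<Prod>i\<in>V. u (\<pi> i) (wt (\<pi> i) - 1) (i + r)) \<in> Q"
    by (simp only: const_inverse[OF alpha_fact_nonzero] mult_1)
  moreover have "vars (act \<pi> (multi_partial V \<alpha> f)) \<subseteq> {..<r}"
    using vars_act[of \<pi> "multi_partial V \<alpha> f"] vars_multi_partial[of V \<alpha> f] V(2) \<pi>(1) by blast
  ultimately show ?case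
    using cancel top_notin[OF V(1) \<pi>] by blast
qed

text \<open>After splitting by assignments, those not allowed contribute elements of
  \<open>Q\<close>; for the others each Taylor term has an exponent that reaches the weight or a
  coefficient covered by \<open>T\<close>.\<close>

lemma mem_of_taylor_coeffs:
  assumes V: "finite V" "vars f \<subseteq> V"
    and T: "\<And>\<pi> \<alpha>. (\<And>i. i \<in> V \<Longrightarrow> \<pi> i < r) \<Longrightarrow> allowed V \<pi> \<Longrightarrow> (\<And>i. i \<in> V \<Longrightarrow> \<alpha> i < wt (\<pi> i))
      \<Longrightarrow> act \<pi> (multi_partial V \<alpha> f) \<in> Q"
  shows "f \<in> P"
proof -
  obtain N0 where N0: "\<And>N \<pi> b. N0 \<le> N \<Longrightarrow> act (\<lambda>i. i + r) f * (\<Prod>i\<in>V. u (\<pi> i) (b i) (i + r))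
     = (\<Sum>\<beta>\<in>PiE V (\<lambda>_. {..N}). const (inverse (alpha_fact V \<beta>)) * act \<pi> (multi_partial V \<beta> f)
         * (\<Prod>i\<in>V. u (\<pi> i) (\<beta> i + b i) (i + r)))"
    using taylor_times_u[OF V] by blast
  have "act (\<lambda>i. i + r) f \<in> Q"
  proof (rule bezout_multi[OF V(1)])
    fix \<pi> assume \<pi>: "\<And>i. i \<in> V \<Longrightarrow> \<pi> i < r"
    show "act (\<lambda>i. i + r) f * (\<Prod>i\<in>V. u (\<pi> i) 0 (i + r)) \<in> Q"
    proof (cases "(\<exists>i\<in>V. wt (\<pi> i) = 0) \<or> \<not> allowed V \<pi>")
      case True
      show ?thesis by (rule ideal_mult(2)[OF QI], rule disallowed_mem[OF V(1) \<pi> True])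
    next
      case False
      show ?thesis unfolding N0[OF order_refl, of \<pi> "\<lambda>_. 0"]
      proof (rule ideal.subspace_sum[OF QI])
        fix \<beta> assume "\<beta> \<in> PiE V (\<lambda>_. {..N0})"
        show "const (inverse (alpha_fact V \<beta>)) * act \<pi> (multi_partial V \<beta> f) * (\<Prod>i\<in>V. u (\<pi> i) (\<beta> i + 0) (i + r)) \<in> Q"
        proof (cases "\<exists>i\<in>V. wt (\<pi> i) \<le> \<beta> i")
          case True
          then obtain i where i: "i \<in> V" "wt (\<pi> i) \<le> \<beta> i" by blast
          then have "u (\<pi> i) (\<beta> i + 0) (i + r) \<in> Q" using \<pi> by (intro wt_mem) auto
          then have "(\<Prod>i\<in>V. u (\<pi> i) (\<beta> i + 0) (i + r)) \<in> Q"
            by (rule ideal_dvd[OF QI]) (use i V in \<open>auto intro: dvd_prodI\<close>)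
          then show ?thesis by (rule ideal_mult[OF QI])
        next
          case F: False
          have "act \<pi> (multi_partial V \<beta> f) \<in> Q" by (rule T) (use \<pi> False F in \<open>auto simp: not_le\<close>)
          then show ?thesis by (intro ideal_mult[OF QI])
        qed
      qed
    qed
  qed
  then show ?thesis by (simp add: over)
qed

lemma cap_ge_one: "j < r \<Longrightarrow> wt j \<noteq> 0 \<Longrightarrow> 1 \<le> cap j"
  using top_prod_notin_iff[of j "{r}"] wt_notin[of j r "wt j - 1"] by (simp add: top_prod_def one_enat_def)

text \<open>Otherwise more variables than the total capacity could not be placed: every assignment
  would be disallowed, and the partition of unity would give \<open>1 \<in> Q\<close>.\<close>

lemma exists_infinite_cap: "\<exists>j<r. wt j \<noteq> 0 \<and> cap j = \<infinity>"
proof (rule ccontr)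
  assume no: "\<not> ?thesis"
  define V where "V = {..<Suc (\<Sum>j<r. the_enat (cap j))}"
  have "1 \<in> Q"
  proof (rule bezout_multi[of V])
    fix \<pi> assume \<pi>: "\<And>i. i \<in> V \<Longrightarrow> \<pi> i < r"
    have "(\<exists>i\<in>V. wt (\<pi> i) = 0) \<or> \<not> allowed V \<pi>"
    proof (rule ccontr)
      assume "\<not> ?thesis"
      then have w: "\<And>i. i \<in> V \<Longrightarrow> wt (\<pi> i) \<noteq> 0" and al: "allowed V \<pi>" by auto
      have "card {i \<in> V. \<pi> i = j} \<le> the_enat (cap j)" if j: "j < r" for j
      proof (cases "wt j = 0")
        case True
        then have e: "{i \<in> V. \<pi> i = j} = {}" using w by blast
        show ?thesis unfolding e by simp
      next
        case False
        then obtain c where "cap j = enat c" using no j by auto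
        then show ?thesis using al j by (auto simp: allowed_def)
      qed
      then have "(\<Sum>j<r. card {i \<in> V. \<pi> i = j}) \<le> (\<Sum>j<r. the_enat (cap j))"
        by (intro sum_mono) auto
      moreover have "(\<Sum>j<r. card {i \<in> V. \<pi> i = j}) = card V"
        using sum.group[of V "{..<r}" \<pi> "\<lambda>_. 1 :: nat"] \<pi> by (auto simp: V_def)
      ultimately show False by (simp add: V_def)
    qed
    then show "1 * (\<Prod>i\<in>V. u (\<pi> i) 0 (i + r)) \<in> Q"
      using disallowed_mem[of V \<pi>] \<pi> by (simp add: V_def)
  qed (simp add: V_def)
  then show False using one_notin by simp
qed

end

section \<open>Partitions and varieties\<close>

lemma infinite_residue_class:
  assumes "a < n" "finite V"
  shows "infinite {i. i \<notin> V \<and> i mod n = (a :: nat)}"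
proof -
  have "inj (\<lambda>m. a + m * n)" using assms(1) by (auto simp: inj_def)
  then have "infinite (range (\<lambda>m. a + m * n))" by (simp add: range_inj_infinite)
  moreover have "range (\<lambda>m. a + m * n) \<subseteq> {i. i mod n = a}" using assms(1) by auto
  ultimately have "infinite ({i. i mod n = a} - V)"
    using assms(2) by (meson Diff_infinite_finite infinite_super)
  moreover have "{i. i mod n = a} - V = {i. i \<notin> V \<and> i mod n = a}" by auto
  ultimately show ?thesis by simp
qed

text \<open>Residue classes modulo \<open>length l\<close> outside \<open>V\<close> are disjoint
  infinite reserves, one per part: a finite part is filled up from its reserve, an infinite part
  takes all of it.\<close>

lemma extend_to_partition:
  assumes l: "inf_partition l" and V: "finite V" and \<rho>0: "\<And>i. i \<in> V \<Longrightarrow> \<rho>0 i < length l"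
    and card_le: "\<And>a. a < length l \<Longrightarrow> enat (card {i \<in> V. \<rho>0 i = a}) \<le> l ! a"
  obtains U where "partition_of_type l U" "\<And>i. i \<in> V \<Longrightarrow> part_index U i = \<rho>0 i"
proof -
  let ?n = "length l"
  have n: "0 < ?n" and l0: "l ! 0 = \<infinity>" using l by (auto simp: inf_partition_def hd_conv_nth)
  let ?C = "\<lambda>a. {i. i \<notin> V \<and> i mod ?n = a}"
  have "\<exists>A. A \<subseteq> ?C a \<and> (if l ! a = \<infinity> then A = ?C a
      else finite A \<and> card A = the_enat (l ! a) - card {i \<in> V. \<rho>0 i = a})" if a: "a < ?n" for a
  proof (cases "l ! a = \<infinity>")
    case False
    obtain B where "finite B" "card B = the_enat (l ! a) - card {i \<in> V. \<rho>0 i = a}" "B \<subseteq> ?C a"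
      using infinite_arbitrarily_large[OF infinite_residue_class[OF a V]] by blast
    then show ?thesis using False by (intro exI[of _ B]) (simp only: if_False simp_thms)
  qed auto
  then have "\<forall>a\<in>{..<?n}. \<exists>A. A \<subseteq> ?C a \<and> (if l ! a = \<infinity> then A = ?C a
      else finite A \<and> card A = the_enat (l ! a) - card {i \<in> V. \<rho>0 i = a})" by blast
  from bchoice[OF this] obtain A where A': "\<forall>a\<in>{..<?n}. A a \<subseteq> ?C a \<and> (if l ! a = \<infinity> then A a = ?C a
      else finite (A a) \<and> card (A a) = the_enat (l ! a) - card {i \<in> V. \<rho>0 i = a})" ..
  have A: "A a \<subseteq> ?C a" "l ! a = \<infinity> \<Longrightarrow> A a = ?C a"
    "l ! a \<noteq> \<infinity> \<Longrightarrow> finite (A a) \<and> card (A a) = the_enat (l ! a) - card {i \<in> V. \<rho>0 i = a}"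
    if "a < ?n" for a
    using bspec[OF A', of a] that by (simp_all split: if_splits)
  \<comment> \<open>Leftover indices go to part 0, which is infinite.\<close>
  define \<rho> where "\<rho> i = (if i \<in> V then \<rho>0 i else if i \<in> A (i mod ?n) then i mod ?n else 0)" for i
  have less: "\<rho> i < ?n" for i using \<rho>0 n by (auto simp: \<rho>_def)
  have ec: "ecard {i. \<rho> i = a} = l ! a" if a: "a < ?n" for a
  proof (cases "l ! a = \<infinity>")
    case True
    then have "?C a \<subseteq> {i. \<rho> i = a}" using A(2)[OF a] by (auto simp: \<rho>_def)
    then have "infinite {i. \<rho> i = a}" using infinite_residue_class[OF a V] infinite_super by blast
    then show ?thesis using True by (simp add: ecard_def)
  next
    case False
    then have "a \<noteq> 0" using l0 by metis
    obtain c where c: "l ! a = enat c" using False by auto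
    have eq: "{i. \<rho> i = a} = {i \<in> V. \<rho>0 i = a} \<union> A a"
      using A(1)[OF a] \<open>a \<noteq> 0\<close> by (auto simp: \<rho>_def split: if_splits)
    have "{i \<in> V. \<rho>0 i = a} \<inter> A a = {}" using A(1)[OF a] by auto
    then have "card {i. \<rho> i = a} = card {i \<in> V. \<rho>0 i = a} + card (A a)"
      unfolding eq using A(3)[OF a False] V by (intro card_Un_disjoint) auto
    also have "\<dots> = c" using A(3)[OF a False] card_le[OF a] c by simp
    finally show ?thesis using c A(3)[OF a False] V by (simp add: ecard_def eq)
  qed
  define U where "U = map (\<lambda>a. {i. \<rho> i = a}) [0..<?n]"
  have U: "U ! a = {i. \<rho> i = a}" if "a < ?n" for a using that by (simp add: U_def)
  have "partition_of_type l U"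
    unfolding partition_of_type_def
  proof (intro conjI allI impI)
    fix a assume a: "a < length U"
    then have an: "a < ?n" by (simp add: U_def)
    show "ecard (U ! a) = l ! a" using ec[OF an] U[OF an] by simp
    have "1 \<le> l ! a" using l an by (auto simp: inf_partition_def)
    then show "U ! a \<noteq> {}"
      using ec[OF an] U[OF an] by (metis card.empty ecard_def finite.emptyI not_one_le_zero zero_enat_def)
  next
    show "\<Union> (set U) = UNIV" using less by (auto simp: U_def)
  qed (auto simp: U_def)
  moreover have "part_index U i = \<rho> i" for i
    unfolding part_index_def by (rule the_equality) (use less U in \<open>auto simp: U_def\<close>)
  ultimately show ?thesis using that by (simp add: \<rho>_def)
qed

lemma part_index_mem:
  assumes "partition_of_type l U"
  shows "part_index U i < length l" "i \<in> U ! part_index U i"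
proof -
  have len: "length U = length l" and dis: "\<And>j k. j < length U \<Longrightarrow> k < length U \<Longrightarrow> j \<noteq> k \<Longrightarrow> U ! j \<inter> U ! k = {}"
    and un: "\<Union> (set U) = UNIV"
    using assms by (auto simp: partition_of_type_def)
  obtain j where "j < length U" "i \<in> U ! j" using un by (metis UNIV_I Union_iff in_set_conv_nth)
  then have "\<exists>!j. j < length U \<and> i \<in> U ! j" using dis by blast
  from theI'[OF this] show "part_index U i < length l" "i \<in> U ! part_index U i"
    unfolding part_index_def len by auto
qed

section \<open>The partition, weights and variety of a centered ideal\<close>

context centered
begin

text \<open>Centers of weight zero, which no variable approaches, are dropped.\<close>

definition centers :: "nat list" where
  "centers = rev (sort_key cap (filter (\<lambda>j. wt j \<noteq> 0) [0..<r]))"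

lemma set_centers: "set centers = {j. j < r \<and> wt j \<noteq> 0}"
  by (auto simp: centers_def)

lemma distinct_centers: "distinct centers"
  by (simp add: centers_def)

lemma centers_nth: "a < length centers \<Longrightarrow> centers ! a < r \<and> wt (centers ! a) \<noteq> 0"
  using nth_mem[of a centers] by (simp add: set_centers)

lemma inf_partition_centers: "inf_partition (map cap centers)"
proof -
  obtain j where j: "j \<in> set centers" "cap j = \<infinity>" using exists_infinite_cap by (auto simp: set_centers)
  then have ne: "centers \<noteq> []" by auto
  have sorted: "sorted_wrt (\<ge>) (map cap centers)"
    unfolding centers_def rev_map[symmetric] sorted_wrt_rev by (simp add: sorted_sort_key)
  have "\<infinity> \<in> set (map cap centers)" using j by force
  then have "hd (map cap centers) \<ge> \<infinity>"
    using sorted ne by (cases "map cap centers") auto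
  then show ?thesis
    unfolding inf_partition_def using ne sorted cap_ge_one by (auto simp: set_centers)
qed

text \<open>Finite capacity excludes weight 2 or more by \<open>cap_infinite\<close>, and centers of
  weight 0 are absent from the list.\<close>

lemma reduced_centers: "reduced (map cap centers) (map wt centers)"
  unfolding reduced_def
proof (intro allI impI)
  fix a assume a: "a < length (map cap centers)" "map cap centers ! a \<noteq> \<infinity>"
  then have "\<not> wt (centers ! a) \<ge> 2" using cap_infinite[of "centers ! a"] centers_nth[of a] by auto
  then show "map wt centers ! a = 1" using a centers_nth[of a] by auto
qed

text \<open>The default 0 is again the index of a center, so \<open>act center_index\<close> maps
  all of \<open>R\<close> to polynomials in the centers, where \<open>cancel\<close> and
  \<open>power_notin\<close> apply.\<close>

definition center_index :: "nat \<Rightarrow> nat" where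
  "center_index a = (if a < length centers then centers ! a else 0)"

lemma center_index_less: "center_index a < r"
  using centers_nth r_pos by (auto simp: center_index_def)

lemma vars_act_center_index: "vars (act center_index h) \<subseteq> {..<r}"
  using vars_act[of center_index h] center_index_less by auto

definition Z :: "complex list set" where
  "Z = {z. length z = length centers \<and> distinct z \<and>
     (\<forall>h. vars h \<subseteq> {..<length centers} \<longrightarrow> act center_index h \<in> Q \<longrightarrow> eval (\<lambda>a. z ! a) h = 0)}"

text \<open>The Nullstellensatz is applied away from \<open>h\<close> times the discriminant of the
  coordinates, so the point it gives has distinct coordinates and \<open>h\<close> does not vanish
  there. No power of this product maps into \<open>Q\<close>, by ordinary primality for polynomials
  in the centers.\<close>

lemma vanishing_Z:
  assumes h: "vars h \<subseteq> {..<length centers}" and van: "\<And>z. z \<in> Z \<Longrightarrow> eval (\<lambda>a. z ! a) h = 0"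
  shows "act center_index h \<in> Q"
proof (rule ccontr)
  assume notin: "act center_index h \<notin> Q"
  let ?n = "length centers"
  let ?g = "h * disc {..<?n}"
  let ?q = "{f. act center_index f \<in> Q}"
  have q: "ideal.subspace ?q"
    by (rule ideal.subspaceI)
      (auto simp: ideal.subspace_0[OF QI] intro: ideal.subspace_add[OF QI] ideal_mult[OF QI])
  have "inj_on center_index {..<?n}" using distinct_centers by (auto simp: inj_on_def center_index_def nth_eq_iff_index_eq)
  then have "act center_index (disc {..<?n}) = disc (center_index ` {..<?n})" by (rule act_disc)
  moreover have "disc (center_index ` {..<?n}) \<notin> Q"
    using disc_dvd[of "{..<r}" "center_index ` {..<?n}"] center_index_less disc_notin ideal_dvd[OF QI] by auto
  ultimately have "act center_index ?g \<notin> Q" using cancel[OF vars_act_center_index] notin by auto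
  then have "?g ^ m \<notin> ?q" for m using power_notin[OF vars_act_center_index, of ?g] by simp
  then obtain x where x: "\<And>f. f \<in> ?q \<Longrightarrow> eval x f = 0" "eval x ?g \<noteq> 0"
    using nullstellensatz[OF q] by blast
  define z where "z = map x [0..<?n]"
  have ev: "eval (\<lambda>a. z ! a) f = eval x f" if "vars f \<subseteq> {..<?n}" for f
    by (rule eval_cong) (use that in \<open>auto simp: z_def\<close>)
  have "x a \<noteq> x b" if "a < ?n" "b < ?n" "a \<noteq> b" for a b
  proof
    assume "x a = x b"
    then have "eval x (var a - var b) = 0" by simp
    moreover have "var a - var b dvd ?g" using diff_dvd_disc[of "{..<?n}" a b] that by auto
    ultimately have "eval x ?g = 0" by (metis dvdE eval_simps(4) mult_zero_left)
    then show False using x(2) by simp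
  qed
  then have "inj_on x {..<?n}" by (intro inj_onI) (metis lessThan_iff)
  then have "distinct z" by (simp add: z_def distinct_map lessThan_atLeast0)
  then have "z \<in> Z" unfolding Z_def using ev x(1) by (auto simp: z_def)
  then have "eval x h = 0" using van[of z] ev[OF h] by simp
  then show False using x(2) by simp
qed

text \<open>Polynomials vanishing on one closed piece each, but not on all of \<open>Z\<close>, have
  a product vanishing on \<open>Z\<close>; it maps into \<open>Q\<close> by
  \<open>vanishing_Z\<close>, and \<open>cancel\<close> yields a contradiction.\<close>

lemma irreducible_Z: "irreducible_closed_in_U (length centers) Z"
  unfolding irreducible_closed_in_U_def
proof (intro conjI allI impI)
  let ?n = "length centers"
  let ?F = "{h. vars h \<subseteq> {..<?n} \<and> act center_index h \<in> Q}"
  have "zariski_closed ?n {z. length z = ?n \<and> (\<forall>f\<in>?F. eval (\<lambda>j. z ! j) f = 0)}"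
    unfolding zariski_closed_def by (rule exI[of _ ?F]) auto
  moreover have "Z = {z. length z = ?n \<and> (\<forall>f\<in>?F. eval (\<lambda>j. z ! j) f = 0)} \<inter> Udist ?n"
    by (auto simp: Z_def Udist_def)
  ultimately show "closed_in_U ?n Z" unfolding closed_in_U_def by blast
  show "Z \<noteq> {}" using vanishing_Z[of 1] one_notin by auto
  fix A B assume cl: "closed_in_U ?n A" "closed_in_U ?n B" and Zeq: "Z = A \<union> B"
  have sep: "\<exists>f z. vars f \<subseteq> {..<?n} \<and> z \<in> Z \<and> eval (\<lambda>j. z ! j) f \<noteq> 0 \<and> (\<forall>z\<in>C. eval (\<lambda>j. z ! j) f = 0)"
    if C: "closed_in_U ?n C" "C \<subseteq> Z" "Z \<noteq> C" for C
  proof -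
    obtain F where F: "\<forall>f\<in>F. vars f \<subseteq> {..<?n}"
      "C = {z. length z = ?n \<and> (\<forall>f\<in>F. eval (\<lambda>j. z ! j) f = 0)} \<inter> Udist ?n"
      using C(1) unfolding closed_in_U_def zariski_closed_def by blast
    obtain z where z: "z \<in> Z" "z \<notin> C" using C by blast
    then have "length z = ?n" "z \<in> Udist ?n" by (auto simp: Z_def Udist_def)
    then obtain f where "f \<in> F" "eval (\<lambda>j. z ! j) f \<noteq> 0" using z F by blast
    then show ?thesis using F z by blast
  qed
  show "Z = A \<or> Z = B"
  proof (rule ccontr)
    assume "\<not> ?thesis"
    then obtain f z g w where f: "vars f \<subseteq> {..<?n}" "z \<in> Z" "eval (\<lambda>j. z ! j) f \<noteq> 0" "\<forall>z\<in>A. eval (\<lambda>j. z ! j) f = 0"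
      and g: "vars g \<subseteq> {..<?n}" "w \<in> Z" "eval (\<lambda>j. w ! j) g \<noteq> 0" "\<forall>z\<in>B. eval (\<lambda>j. z ! j) g = 0"
      using sep[OF cl(1)] sep[OF cl(2)] Zeq by (metis Un_upper1 Un_upper2)
    have "act center_index (f * g) \<in> Q"
      by (rule vanishing_Z) (use f g Zeq vars_mult[of f g] in auto)
    then have "act center_index f \<in> Q \<or> act center_index g \<in> Q" using cancel[OF vars_act_center_index] by simp
    then show False using f g by (auto simp: Z_def)
  qed
qed

text \<open>Evaluating a derivative at a point of \<open>X_points U Z\<close> substitutes for each
  variable the coordinate of its part. By \<open>vanishing_Z\<close>, vanishing on all of
  \<open>Z\<close> means that the corresponding Taylor coefficient lies in \<open>Q\<close>;
  partitions and allowed assignments determine each other on finitely many variables.\<close>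

lemma P_eq_P_ideal: "P = P_ideal (map cap centers) (map wt centers) Z"
proof (intro equalityI subsetI)
  let ?n = "length centers"
  fix f assume f: "f \<in> P"
  show "f \<in> P_ideal (map cap centers) (map wt centers) Z"
    unfolding P_ideal_def mem_Collect_eq
  proof (intro allI impI)
    fix U x D
    assume U: "partition_of_type (map cap centers) U" and x: "x \<in> X_points U Z"
      and D: "distinct (map fst D)" "\<forall>(i, k)\<in>set D. k < map wt centers ! part_index U i"
    let ?\<rho> = "part_index U"
    let ?\<pi> = "\<lambda>i. centers ! ?\<rho> i"
    obtain z where z: "z \<in> Z" "\<And>i. x i = z ! ?\<rho> i" using x by (auto simp: X_points_def)
    have \<rho>: "?\<rho> i < ?n" "i \<in> U ! ?\<rho> i" for i using part_index_mem[OF U, of i] by auto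
    define V where "V = vars f \<union> fst ` set D"
    have V: "finite V" "vars f \<subseteq> V" using finite_vars by (auto simp: V_def)
    define \<alpha> where "\<alpha> i = (case map_of D i of Some k \<Rightarrow> k | None \<Rightarrow> 0)" for i
    have \<alpha>1: "\<alpha> i = k" if "(i, k) \<in> set D" for i k
      using that D(1) by (simp add: \<alpha>_def)
    have \<alpha>2: "\<alpha> i = 0" if "i \<notin> fst ` set D" for i
      using that map_of_eq_None_iff[of D i] by (simp add: \<alpha>_def)
    have "act ?\<pi> (multi_partial V \<alpha> f) \<in> Q"
    proof (rule taylor_coeff_mem[OF f V])
      show "?\<pi> i < r" for i using centers_nth \<rho> by blast
      \<comment> \<open>The variables assigned to one center lie in one part of \<open>U\<close>,
        whose size is the capacity.\<close>
      show "allowed V ?\<pi>"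
        unfolding allowed_def
      proof (intro allI impI)
        fix j assume "j < r"
        show "enat (card {i \<in> V. ?\<pi> i = j}) \<le> cap j"
        proof (cases "{i \<in> V. ?\<pi> i = j} = {}")
          case True
          show ?thesis unfolding True by (simp add: zero_enat_def[symmetric])
        next
          case False
          then obtain i0 where i0: "?\<pi> i0 = j" by blast
          let ?a = "?\<rho> i0"
          have sub: "{i \<in> V. ?\<pi> i = j} \<subseteq> U ! ?a"
          proof
            fix i assume "i \<in> {i \<in> V. ?\<pi> i = j}"
            then have "centers ! ?\<rho> i = centers ! ?a" using i0 by simp
            then have "?\<rho> i = ?a"
              by (simp only: nth_eq_iff_index_eq[OF distinct_centers \<rho>(1) \<rho>(1)])
            then show "i \<in> U ! ?a" using \<rho>(2)[of i] by simp
          qed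
          have "ecard (U ! ?a) = cap j"
            using U \<rho>(1)[of i0] i0 by (auto simp: partition_of_type_def)
          then have cj: "cap j = ecard (U ! ?a)" by simp
          show ?thesis
            unfolding cj using card_mono[OF _ sub] by (auto simp: ecard_def)
        qed
      qed
      show "\<alpha> i < wt (?\<pi> i)" if "i \<in> V" for i
      proof (cases "i \<in> fst ` set D")
        case True
        then obtain k where k: "(i, k) \<in> set D" by auto
        then show ?thesis using D(2) \<alpha>1[OF k] \<rho>(1)[of i] by auto
      next
        case False
        then show ?thesis using \<alpha>2 centers_nth[OF \<rho>(1)[of i]] by simp
      qed
    qed
    moreover have "act ?\<pi> (multi_partial V \<alpha> f) = act center_index (act ?\<rho> (multi_partial V \<alpha> f))"
      unfolding act_act using \<rho> by (intro act_cong) (simp add: center_index_def)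
    moreover have "vars (act ?\<rho> (multi_partial V \<alpha> f)) \<subseteq> {..<?n}"
      using vars_act[of ?\<rho> "multi_partial V \<alpha> f"] \<rho> by auto
    ultimately have "eval (\<lambda>a. z ! a) (act ?\<rho> (multi_partial V \<alpha> f)) = 0" using z(1) by (simp add: Z_def)
    moreover have "x = (\<lambda>i. z ! ?\<rho> i)" using z(2) by auto
    moreover have "partials D f = multi_partial V \<alpha> f"
      by (rule partials_eq_multi_partial) (use D V \<alpha>1 \<alpha>2 in \<open>auto simp: V_def\<close>)
    ultimately show "eval x (partials D f) = 0" by (simp add: eval_act)
  qed
next
  let ?n = "length centers"
  fix f assume f: "f \<in> P_ideal (map cap centers) (map wt centers) Z"
  have V: "finite (vars f)" by (rule finite_vars)
  show "f \<in> P"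
  proof (rule mem_of_taylor_coeffs[OF V order_refl])
    fix \<pi> \<alpha>
    assume \<pi>: "\<And>i. i \<in> vars f \<Longrightarrow> \<pi> i < r" and al: "allowed (vars f) \<pi>"
      and \<alpha>: "\<And>i. i \<in> vars f \<Longrightarrow> \<alpha> i < wt (\<pi> i)"
    \<comment> \<open>\<open>\<alpha> i < wt (\<pi> i)\<close> excludes weight 0, so
      \<open>\<pi> i\<close> is among the retained centers.\<close>
    have "\<exists>a<?n. centers ! a = \<pi> i" if "i \<in> vars f" for i
      using \<pi>[OF that] \<alpha>[OF that] set_centers by (auto simp: in_set_conv_nth[symmetric])
    then obtain \<rho> where \<rho>: "\<And>i. i \<in> vars f \<Longrightarrow> \<rho> i < ?n \<and> centers ! \<rho> i = \<pi> i" by metis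
    have "enat (card {i \<in> vars f. \<rho> i = a}) \<le> map cap centers ! a" if a: "a < ?n" for a
    proof -
      have "{i \<in> vars f. \<rho> i = a} \<subseteq> {i \<in> vars f. \<pi> i = centers ! a}" using \<rho> by auto
      then have "card {i \<in> vars f. \<rho> i = a} \<le> card {i \<in> vars f. \<pi> i = centers ! a}"
        using V by (intro card_mono) auto
      moreover have "enat (card {i \<in> vars f. \<pi> i = centers ! a}) \<le> cap (centers ! a)"
        using al centers_nth[OF a] by (simp add: allowed_def)
      ultimately show ?thesis using a by (auto intro: order_trans[rotated])
    qed
    then obtain U where U: "partition_of_type (map cap centers) U" "\<And>i. i \<in> vars f \<Longrightarrow> part_index U i = \<rho> i"
      using extend_to_partition[OF inf_partition_centers V, of \<rho>] \<rho> by auto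
    let ?D = "map (\<lambda>i. (i, \<alpha> i)) (sorted_list_of_set (vars f))"
    let ?h = "act \<rho> (multi_partial (vars f) \<alpha> f)"
    have "act center_index ?h \<in> Q"
    proof (rule vanishing_Z)
      show "vars ?h \<subseteq> {..<?n}" using vars_act[of \<rho> "multi_partial (vars f) \<alpha> f"] vars_multi_partial[of "vars f" \<alpha> f] \<rho> by fastforce
      fix z assume z: "z \<in> Z"
      let ?x = "\<lambda>i. z ! part_index U i"
      have "?x \<in> X_points U Z" using z by (auto simp: X_points_def)
      moreover have "distinct (map fst ?D)" by (simp add: comp_def)
      moreover have "\<forall>(i, k)\<in>set ?D. k < map wt centers ! part_index U i"
        using V U(2) \<rho> \<alpha> by auto
      ultimately have "eval ?x (partials ?D f) = 0" using f U(1) unfolding P_ideal_def by blast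
      then have "eval ?x (multi_partial (vars f) \<alpha> f) = 0" by (simp add: multi_partial_def)
      moreover have "eval ?x (multi_partial (vars f) \<alpha> f) = eval (\<lambda>i. z ! \<rho> i) (multi_partial (vars f) \<alpha> f)"
        by (rule eval_cong) (use U(2) vars_multi_partial[of "vars f" \<alpha> f] in auto)
      ultimately show "eval (\<lambda>a. z ! a) ?h = 0" by (simp add: eval_act)
    qed
    moreover have "act center_index ?h = act \<pi> (multi_partial (vars f) \<alpha> f)"
      unfolding act_act
      by (rule act_cong) (use \<rho> vars_multi_partial[of "vars f" \<alpha> f] in \<open>auto simp: center_index_def\<close>)
    ultimately show "act \<pi> (multi_partial (vars f) \<alpha> f) \<in> Q" by simp
  qed
qed

end

theorem theorem1p10:
  fixes P :: "R set"
  assumes "S_prime P" and "P \<noteq> {0}"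
  shows "\<exists>l e Z. inf_partition l \<and> weight_vector (length l) e \<and> reduced l e \<and>
           irreducible_closed_in_U (length l) Z \<and> P = P_ideal l e Z"
proof -
  obtain r k where r: "r \<ge> 1" and nk: "\<And>K. disc {..<r} ^ K \<notin> P"
    and k: "\<And>A. finite A \<Longrightarrow> card A = Suc r \<Longrightarrow> disc A ^ k \<in> P"
    by (rule S_prime_rank[OF assms]) blast
  obtain Q where "stable_ideal r Q" "orbit_prime r Q" "disc {..<r} \<notin> Q"
    "\<And>f. act (\<lambda>i. i + r) f \<in> Q \<longleftrightarrow> f \<in> P"
    "\<And>i. r \<le> i \<Longrightarrow> (\<Prod>j<r. (var i - var j) ^ (2 * k)) \<in> Q"
    by (rule exists_centered_ideal[OF assms(1) nk k]) blast+
  then interpret centered P Q r "2 * k"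
    by unfold_locales (use r in auto)
  have "weight_vector (length centers) (map wt centers)"
    using set_centers by (auto simp: weight_vector_def Suc_le_eq)
  then show ?thesis
    using inf_partition_centers reduced_centers irreducible_Z P_eq_P_ideal
    by (intro exI[of _ "map cap centers"] exI[of _ "map wt centers"] exI[of _ Z]) simp
qed

end
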